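(* Let $\Gamma$ be a singular branch of plane curve. Then $\Lambda_\Gamma$ is a $\mathcal C$-collection; that is, $\Lambda_\Gamma+\mathcal S_\Gamma\subset\Lambda_\Gamma$, and for every $m\in\Lambda_\Gamma$ and all $1\le j\le k\le g$ with $m\le\overline\beta_j$ one has $m+\overline\beta_k-\overline\beta_j\in\Lambda_\Gamma$.
   Context: Let $\Gamma$ be a singular irreducible germ of holomorphic curve at $0\in\mathbb C^2$ with Puiseux parametrization $\Gamma(t)=(t^n,\sum_{\beta\ge\beta_1}a_{\beta,\Gamma}t^\beta)$, where $n\ge2$ is its multiplicity and $\beta_1<\dots<\beta_g$ ($g\ge1$) are its Puiseux characteristic exponents. Put $e_0=n$, $e_j=\gcd(e_{j-1},\beta_j)$, $n_j=e_{j-1}/e_j$ for $1\le j\le g$. Define $\overline\beta_1=\beta_1$ and $\overline\beta_j=n_{j-1}\overline\beta_{j-1}-\beta_{j-1}+\beta_j$ for $2\le j\le g$. For $f\in\mathbb C[[x,y]]$ let $\nu_\Gamma(f)=\mathrm{ord}_t f(\Gamma(t))$; for a (formal) 1-form $\omega=a\,dx+b\,dy$ write $\Gamma^*\omega=h(t)\,dt$ and set $\nu_\Gamma(\omega)=\mathrm{ord}_t h+1$ ($=\infty$ if $h\equiv0$). The semigroup of $\Gamma$ is $\mathcal S_\Gamma=\{\nu_\Gamma(f):f\in\mathbb C\{x,y\},\ f(0)=0\}$; it is minimally generated by $n,\overline\beta_1,\dots,\overline\beta_g$. Let $\Lambda_\Gamma=\{\nu_\Gamma(\omega):\omega \text{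 a germ of holomorphic 1-form at }0\}\setminus\{\infty\}\subset\mathbb Z_{>0}$. *)

theory Defs
  imports "HOL-Analysis.Analysis"
begin

text \<open>A branch is given by its Puiseux parametrization
  Gamma(t) = (t^n, phi(t)), phi(t) = sum_k a_k t^k, a convergent power series.\<close>

definition puiseux_phi :: "(nat \<Rightarrow> complex) \<Rightarrow> complex \<Rightarrow> complex" where
  "puiseux_phi a t = (\<Sum>k. a k * t ^ k)"

definition puiseux_param :: "nat \<Rightarrow> (nat \<Rightarrow> complex) \<Rightarrow> complex \<Rightarrow> complex \<times> complex" where
  "puiseux_param n a t = (t ^ n, puiseux_phi a t)"

primrec puiseux_e :: "nat \<Rightarrow> (nat \<Rightarrow> complex) \<Rightarrow> nat \<Rightarrow> nat" where
  "puiseux_e n a 0 = n"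
| "puiseux_e n a (Suc j) =
     gcd (puiseux_e n a j) (LEAST k. a k \<noteq> 0 \<and> \<not> puiseux_e n a j dvd k)"

text \<open>Characteristic exponent beta_j (meaningful for j >= 1).\<close>
definition puiseux_beta :: "nat \<Rightarrow> (nat \<Rightarrow> complex) \<Rightarrow> nat \<Rightarrow> nat" where
  "puiseux_beta n a j = (LEAST k. a k \<noteq> 0 \<and> \<not> puiseux_e n a (j - 1) dvd k)"

text \<open>Number g of characteristic exponents: the least g with e_g = 1.\<close>
definition puiseux_g :: "nat \<Rightarrow> (nat \<Rightarrow> complex) \<Rightarrow> nat" where
  "puiseux_g n a = (LEAST j. puiseux_e n a j = 1)"

text \<open>betabar_1 = beta_1, betabar_{j+1} = n_j betabar_j - beta_j + beta_{j+1},
  with n_j = e_{j-1} / e_j. (Index 0 unused.)\<close>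
fun puiseux_betabar :: "nat \<Rightarrow> (nat \<Rightarrow> complex) \<Rightarrow> nat \<Rightarrow> nat" where
  "puiseux_betabar n a 0 = 0"
| "puiseux_betabar n a (Suc j) =
     (if j = 0 then puiseux_beta n a 1
      else (puiseux_e n a (j - 1) div puiseux_e n a j) * puiseux_betabar n a j
           + puiseux_beta n a (Suc j) - puiseux_beta n a j)"

definition hol_germ2 :: "(complex \<times> complex \<Rightarrow> complex) \<Rightarrow> bool" where
  "hol_germ2 f \<longleftrightarrow> (\<exists>c :: nat \<Rightarrow> nat \<Rightarrow> complex. \<exists>r > 0.
      (\<lambda>(i, j). norm (c i j) * r ^ (i + j)) summable_on (UNIV :: (nat \<times> nat) set) \<and>
      (\<forall>x y. norm x < r \<and> norm y < r \<longrightarrow>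
          f (x, y) = (\<Sum>\<^sub>\<infinity>(i, j) \<in> UNIV. c i j * x ^ i * y ^ j)))"

definition has_finite_ord0 :: "(complex \<Rightarrow> complex) \<Rightarrow> bool" where
  "has_finite_ord0 h \<longleftrightarrow> (\<exists>k. (deriv ^^ k) h 0 \<noteq> 0)"

definition ord0 :: "(complex \<Rightarrow> complex) \<Rightarrow> nat" where
  "ord0 h = (LEAST k. (deriv ^^ k) h 0 \<noteq> 0)"

text \<open>Pullback of omega = A dx + B dy: Gamma^* omega = h(t) dt.\<close>
definition pullback_coeff ::
  "nat \<Rightarrow> (nat \<Rightarrow> complex) \<Rightarrow> (complex \<times> complex \<Rightarrow> complex) \<Rightarrow> (complex \<times> complex \<Rightarrow> complex)
   \<Rightarrow> complex \<Rightarrow> complex" where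
  "pullback_coeff n a A B t =
     A (puiseux_param n a t) * (of_nat n * t ^ (n - 1))
   + B (puiseux_param n a t) * deriv (puiseux_phi a) t"

definition semigroup_Gamma :: "nat \<Rightarrow> (nat \<Rightarrow> complex) \<Rightarrow> nat set" where
  "semigroup_Gamma n a =
     {ord0 (f \<circ> puiseux_param n a) | f. hol_germ2 f \<and> f (0, 0) = 0
                                          \<and> has_finite_ord0 (f \<circ> puiseux_param n a)}"

definition Lambda_Gamma :: "nat \<Rightarrow> (nat \<Rightarrow> complex) \<Rightarrow> nat set" where
  "Lambda_Gamma n a =
     {ord0 (pullback_coeff n a A B) + 1 | A B. hol_germ2 A \<and> hol_germ2 B
                                        \<and> has_finite_ord0 (pullback_coeff n a A B)}"

end

(* Write x = t^n, let psi_j be the truncation of the Puiseux series phi below beta_j, with conjugates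
   psi_{j,k}(t) = psi_j(z^k t), z a primitive n-th root of unity, and let f_j be their minimal
   polynomial; f_j(phi) has order betabar_j. It suffices to treat k = j + 1.

   Partial fractions in y give, up to f_j times a form of positive value,
     omega / f_j = sum_k b_k dlog(y - psi_{j,k}) + sum_k p_k dx / (f_j'(psi_{j,k}) (y - psi_{j,k})),
   where p dx is the restriction of omega to the truncated branch and b is the residue. On Gamma the
   first sum has order exactly ord b, because its leading coefficient is a nonzero multiple of a
   character sum of the contact orders, which is positive. The second has order ord p - betabar_j.
   The two never agree modulo e_{j-1}, so a value m <= betabar_j comes from exactly one of b, p.
   Residue duality makes (omega, omega') -> res (b p' - b' p) vanish, and therefore
   betabar_j - m is not a differential value of the truncation psi_{j+1}. By linear algebra there is
   then a Laurent series b of order m - betabar_j whose residue pairing with all forms restricted to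
   psi_{j+1} vanishes. This means exactly that f_{j+1} sum_k b_k dlog(y - psi_{j+1,k}) is a form with
   coefficients in C[[x]][y]. Its value on Gamma is betabar_{j+1} + m - betabar_j.

   Differential values depend on finitely many Taylor coefficients only, so that convergent and
   formal coefficients give the same set. *)

theory Submission
  imports Defs "HOL-Complex_Analysis.Complex_Analysis"
begin

unbundle fps_syntax
unbundle no vec_syntax

section \<open>Orders of Laurent series\<close>

text \<open>A lower bound for the order instead of an order function: it holds for the zero series
  and passes to sums even when leading terms cancel.\<close>

definition vanish :: "int \<Rightarrow> 'a::zero fls \<Rightarrow> bool" where
  "vanish m f \<longleftrightarrow> (\<forall>i<m. f $$ i = 0)"

lemma vanishD: "vanish m f \<Longrightarrow> i < m \<Longrightarrow> f $$ i = 0"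
  by (simp add: vanish_def)

lemma vanish_mono: "vanish m f \<Longrightarrow> k \<le> m \<Longrightarrow> vanish k f"
  by (auto simp: vanish_def)

lemma vanish_0 [simp]: "vanish m 0"
  by (simp add: vanish_def)

lemma vanish_add: "vanish m f \<Longrightarrow> vanish m g \<Longrightarrow> vanish m (f + g)"
  for f :: "'a::monoid_add fls"
  by (simp add: vanish_def)

lemma vanish_sum: "(\<And>k. k \<in> K \<Longrightarrow> vanish m (f k)) \<Longrightarrow> vanish m (\<Sum>k\<in>K. f k)"
  for f :: "'b \<Rightarrow> 'a::comm_monoid_add fls"
  by (induction K rule: infinite_finite_induct) (auto intro: vanish_add)

lemma vanish_subdegree [simp]: "vanish (fls_subdegree f) f"
  by (simp add: vanish_def)

lemma vanish_imp_subdegree: "vanish m f \<Longrightarrow> f \<noteq> 0 \<Longrightarrow> m \<le> fls_subdegree f"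
  by (metis vanish_def fls_subdegree_geI)

text \<open>The product formula at \<open>m + k\<close> also holds when \<open>m\<close> or
  \<open>k\<close> lies below the true order, both sides then being 0. Leading coefficients can so
  be multiplied before it is known whether they vanish.\<close>

lemma vanish_mult:
  fixes f g :: "'a::field fls"
  assumes "vanish m f" "vanish k g"
  shows "vanish (m + k) (f * g)" "(f * g) $$ (m + k) = f $$ m * g $$ k"
proof -
  show "vanish (m + k) (f * g)"
  proof (cases "f = 0 \<or> g = 0")
    case False
    then show ?thesis
      using vanish_imp_subdegree[OF assms(1)] vanish_imp_subdegree[OF assms(2)]
      by (auto simp: vanish_def fls_times_nth_eq0)
  qed auto
  show "(f * g) $$ (m + k) = f $$ m * g $$ k"
  proof (cases "f = 0 \<or> g = 0")
    case False
    then have le: "m \<le> fls_subdegree f" "k \<le> fls_subdegree g"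
      using vanish_imp_subdegree assms by blast+
    show ?thesis
    proof (cases "m = fls_subdegree f \<and> k = fls_subdegree g")
      case True
      then show ?thesis by simp
    next
      case False
      then have "f $$ m * g $$ k = 0" "m + k < fls_subdegree f + fls_subdegree g"
        using le by auto
      then show ?thesis by (simp add: fls_times_nth_eq0)
    qed
  qed auto
qed

lemma vanish_inverse:
  fixes g :: "'a::field fls"
  assumes "vanish m g" "g $$ m \<noteq> 0"
  shows "vanish (- m) (inverse g)" "inverse g $$ (- m) = inverse (g $$ m)"
proof -
  have sd: "fls_subdegree g = m"
    using assms by (intro fls_subdegree_eqI) (auto simp: vanish_def)
  have ne: "g \<noteq> 0" using assms by auto
  show v: "vanish (- m) (inverse g)"
    by (metis fls_inverse_subdegree sd vanish_subdegree)
  have "(g * inverse g) $$ (m + - m) = g $$ m * inverse g $$ (- m)"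
    by (rule vanish_mult[OF assms(1) v])
  with ne assms(2) show "inverse g $$ (- m) = inverse (g $$ m)"
    by (simp add: field_simps)
qed

lemma vanish_divide:
  fixes f g :: "'a::field fls"
  assumes "vanish k f" "vanish m g" "g $$ m \<noteq> 0"
  shows "vanish (k - m) (f / g)" "(f / g) $$ (k - m) = f $$ k / g $$ m"
  using vanish_mult[OF assms(1) vanish_inverse(1)[OF assms(2,3)]] vanish_inverse(2)[OF assms(2,3)]
  by (simp_all add: field_simps)

lemma vanish_prod:
  fixes f :: "'b \<Rightarrow> 'a::field fls"
  assumes "finite K" "\<And>k. k \<in> K \<Longrightarrow> vanish (m k) (f k)"
  shows "vanish (\<Sum>k\<in>K. m k) (\<Prod>k\<in>K. f k) \<and> (\<Prod>k\<in>K. f k) $$ (\<Sum>k\<in>K. m k) = (\<Prod>k\<in>K. f k $$ m k)"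
  using assms
proof (induction K)
  case empty
  show ?case by (simp add: vanish_def)
next
  case (insert x K)
  then show ?case using vanish_mult[of "m x" "f x" "sum m K" "prod f K"] by simp
qed

section \<open>Divided differences\<close>

text \<open>Lagrange form of the divided difference of \<open>G\<close> at the nodes
  \<open>c i\<close>. Laurent series are used because differences of nodes need not be units among
  power series.\<close>

definition divdiff :: "'i set \<Rightarrow> ('i \<Rightarrow> complex fps) \<Rightarrow> complex fps poly \<Rightarrow> complex fls" where
  "divdiff I c G = (\<Sum>i\<in>I. fps_to_fls (poly G (c i)) / (\<Prod>l\<in>I - {i}. fps_to_fls (c i - c l)))"

lemma divdiff_add: "divdiff I c (G + H) = divdiff I c G + divdiff I c H"
  by (simp add: divdiff_def add_divide_distrib sum.distrib)

lemma divdiff_const: "divdiff I c [:g:] = fps_to_fls g * divdiff I c 1"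
  by (simp add: divdiff_def sum_distrib_left)

text \<open>The linear factor kills the term of the new node and cancels the new denominator factor
  in all other terms.\<close>

lemma divdiff_insert_linear:
  assumes fin: "finite I" and "a \<notin> I" and inj: "inj_on c (insert a I)"
  shows "divdiff (insert a I) c ([:- c a, 1:] * Q) = divdiff I c Q"
proof -
  have "fps_to_fls (poly ([:- c a, 1:] * Q) (c i)) / (\<Prod>l\<in>insert a I - {i}. fps_to_fls (c i - c l))
      = fps_to_fls (poly Q (c i)) / (\<Prod>l\<in>I - {i}. fps_to_fls (c i - c l))" if "i \<in> I" for i
  proof -
    have "c i \<noteq> c a" using inj that \<open>a \<notin> I\<close> by (auto simp: inj_on_def)
    then have nz: "fps_to_fls (c i - c a) \<noteq> 0" by (simp del: fps_to_fls_minus)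
    have "insert a I - {i} = insert a (I - {i})" using that \<open>a \<notin> I\<close> by auto
    then have "(\<Prod>l\<in>insert a I - {i}. fps_to_fls (c i - c l))
      = fps_to_fls (c i - c a) * (\<Prod>l\<in>I - {i}. fps_to_fls (c i - c l))"
      using fin \<open>a \<notin> I\<close> by simp
    moreover have "fps_to_fls (poly ([:- c a, 1:] * Q) (c i)) = fps_to_fls (c i - c a) * fps_to_fls (poly Q (c i))"
      by (simp only: fls_times_fps_to_fls poly_mult) simp
    ultimately show ?thesis
      by (simp only: mult_divide_mult_cancel_left[OF nz])
  qed
  then show ?thesis
    using fin \<open>a \<notin> I\<close> by (simp add: divdiff_def)
qed

text \<open>Y - c_a and Y - c_b have the same divided difference, since each removes one node. They
  differ by a nonzero constant, so the divided difference of 1 vanishes.\<close>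

lemma divdiff_one:
  assumes "finite I" "inj_on c I" "card I \<ge> 2"
  shows "divdiff I c 1 = 0"
  using assms
proof (induction "card I" arbitrary: I rule: less_induct)
  case less
  obtain a where a: "a \<in> I" using less.prems by fastforce
  obtain b where b: "b \<in> I" "b \<noteq> a"
    using less.prems a by (metis card_1_singleton_iff card_le_Suc0_iff_eq not_less_eq_eq numeral_2_eq_2)
  have *: "divdiff I c [:- c x, 1:] = divdiff (I - {x}) c 1" if "x \<in> I" for x
    using divdiff_insert_linear[of "I - {x}" x c 1] that less.prems by (simp add: insert_absorb)
  \<comment> \<open>The value does not depend on the removed node: 1 if a single node remains,
    otherwise 0 by induction.\<close>
  have val: "divdiff (I - {x}) c 1 = (if card I = 2 then 1 else 0)" if "x \<in> I" for x
  proof (cases "card I = 2")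
    case True
    then have "card (I - {x}) = 1" using that by simp
    then obtain z where z: "I - {x} = {z}" by (rule card_1_singletonE)
    have "divdiff {z} c 1 = 1" by (simp add: divdiff_def)
    then show ?thesis by (simp only: z True if_True refl)
  next
    case False
    have "card (I - {x}) = card I - 1" using that less.prems by simp
    then have "divdiff (I - {x}) c 1 = 0"
      using False less.prems that by (intro less.hyps) (auto intro: inj_on_subset)
    then show ?thesis using False by simp
  qed
  have "divdiff I c [:- c a, 1:] = divdiff I c [:- c b, 1:] "
    using * val a b by simp
  moreover have "[:- c b, 1:] = [:- c a, 1:] + [:c a - c b:]" by simp
  ultimately have "divdiff I c [:c a - c b:] = 0"
    by (simp only: divdiff_add) simp
  moreover have "c a \<noteq> c b" using less.prems a b by (auto simp: inj_on_def)
  ultimately show ?case by (simp add: divdiff_const del: fps_to_fls_minus)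
qed

text \<open>Newton's scheme: division by Y - c_a removes a node, and the constant remainder
  contributes nothing while there are two nodes. At a single node the divided difference is a value
  of a polynomial.\<close>

lemma divdiff_integral:
  assumes "finite I" "I \<noteq> {}" "inj_on c I"
  shows "\<exists>r. divdiff I c G = fps_to_fls r"
  using assms
proof (induction I arbitrary: G rule: finite_ne_induct)
  case (singleton x)
  then show ?case by (auto simp: divdiff_def)
next
  case (insert a I)
  let ?Q = "synthetic_div G (c a)"
  have G: "G = [:- c a, 1:] * ?Q + [:poly G (c a):]"
    by (rule synthetic_div_correct'[symmetric])
  have "card (insert a I) \<ge> 2"
    using insert.hyps by (simp add: Suc_le_eq card_gt_0_iff)
  then have "divdiff (insert a I) c [:poly G (c a):] = 0"
    using insert.hyps insert.prems by (simp add: divdiff_const divdiff_one)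
  then have "divdiff (insert a I) c G = divdiff I c ?Q"
    using insert.hyps insert.prems
    by (subst G, subst divdiff_add, subst divdiff_insert_linear) auto
  moreover have "\<exists>r. divdiff I c ?Q = fps_to_fls r"
    using insert.prems by (intro insert.IH) auto
  ultimately show ?case by simp
qed

section \<open>Pullbacks of formal forms\<close>

definition euler :: "complex fps \<Rightarrow> complex fps" where
  "euler f = fps_X * fps_deriv f"

lemma euler_nth [simp]: "euler f $ i = of_nat i * f $ i"
  by (cases i) (simp_all add: euler_def)

lemma euler_diff: "euler (f - g) = euler f - euler g"
  by (simp add: fps_eq_iff algebra_simps)

text \<open>The coefficient of \<open>dt / t\<close> in the pullback of \<open>A dx + B dy\<close> to \<open>(t ^ n, y t)\<close>, so that its order is the
  differential value without shift. Here \<open>A\<close> and \<open>B\<close> are polynomials in \<open>y\<close>, and membership of their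
  coefficients in \<open>C[[x]]\<close> is the condition \<open>coeffs_in_power\<close> below.\<close>

definition form_pullback :: "nat \<Rightarrow> complex fps poly \<Rightarrow> complex fps poly \<Rightarrow> complex fps \<Rightarrow> complex fps" where
  "form_pullback n A B y = poly A y * (of_nat n * fps_X ^ n) + poly B y * euler y"

definition coeffs_in_power :: "nat \<Rightarrow> complex fps poly \<Rightarrow> bool" where
  "coeffs_in_power n A \<longleftrightarrow> (\<forall>i m. coeff A i $ m \<noteq> 0 \<longrightarrow> n dvd m)"

text \<open>Substitution of z t for t. If z is an n-th root of unity, this is the Galois action on
  C((t)) over C((x)) with x = t^n; \<open>rotp\<close> is its version on power series.\<close>

definition rot :: "complex \<Rightarrow> complex fls \<Rightarrow> complex fls" where
  "rot z f = fls_compose_fps f (fps_const z * fps_X)"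

definition rotp :: "complex \<Rightarrow> complex fps \<Rightarrow> complex fps" where
  "rotp z f = f oo (fps_const z * fps_X)"

lemma rotp_nth [simp]: "rotp z f $ i = z ^ i * f $ i"
  by (simp add: rotp_def fps_compose_linear)

lemma rot_nth [simp]: "z \<noteq> 0 \<Longrightarrow> rot z f $$ i = z powi i * f $$ i"
  unfolding rot_def by (subst fls_nth_fls_compose_fps_linear) simp_all

lemma rot_fps_to_fls: "z \<noteq> 0 \<Longrightarrow> rot z (fps_to_fls f) = fps_to_fls (rotp z f)"
  by (simp add: rot_def rotp_def)

lemma rot_mult: "z \<noteq> 0 \<Longrightarrow> rot z (f * g) = rot z f * rot z g"
  by (simp add: rot_def fls_compose_fps_mult)

lemma rot_divide: "z \<noteq> 0 \<Longrightarrow> rot z (f / g) = rot z f / rot z g"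
  by (simp add: rot_def fls_compose_fps_divide)

lemma rotp_mult: "rotp z (f * g) = rotp z f * rotp z g"
  by (simp add: rotp_def fps_compose_mult_distrib)

lemma rotp_add: "rotp z (f + g) = rotp z f + rotp z g"
  by (simp add: rotp_def fps_compose_add_distrib)

lemma rotp_euler: "rotp z (euler f) = euler (rotp z f)"
  by (simp add: fps_eq_iff)

lemma rotp_poly:
  assumes "\<And>i. rotp z (coeff A i) = coeff A i"
  shows "rotp z (poly A y) = poly A (rotp z y)"
  using assms
proof (induction A)
  case 0
  then show ?case by (simp add: fps_eq_iff)
next
  case (pCons a A)
  have "rotp z (coeff A i) = coeff A i" for i
    using pCons.prems[of "Suc i"] by simp
  moreover have "rotp z a = a" using pCons.prems[of 0] by simp
  ultimately show ?case by (simp add: rotp_add rotp_mult pCons.IH)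
qed

lemma prod_lessThan_shift_cyclic:
  fixes g :: "nat \<Rightarrow> 'b::comm_monoid_mult"
  assumes "g N = g 0"
  shows "(\<Prod>k<N. g (Suc k)) = (\<Prod>k<N. g k)"
proof (cases N)
  case (Suc M)
  with assms show ?thesis
    by (simp only: prod.lessThan_Suc[of "\<lambda>k. g (Suc k)"] prod.lessThan_Suc_shift[of g]) (simp add: mult.commute)
qed simp

section \<open>Conjugates of a truncated branch\<close>

text \<open>\<open>psi\<close> lies in C((t^e)), which has degree N over C((x)). By
  \<open>psi_conj\<close> its N conjugates are distinct, and by \<open>root_iff\<close> the number
  \<open>z\<close> is a primitive n-th root of unity.\<close>

locale conjugate_family =
  fixes n e N :: nat and z :: complex and psi :: "complex fps"
  assumes n_eq: "n = N * e" and n_pos: "0 < n"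
    and root_iff: "\<And>m. z ^ m = 1 \<longleftrightarrow> n dvd m"
    and psi_supp: "\<And>m. psi $ m \<noteq> 0 \<Longrightarrow> e dvd m"
    and psi_conj: "\<And>k. 0 < k \<Longrightarrow> k < N \<Longrightarrow> rotp (z ^ k) psi \<noteq> psi"
begin

lemma N_pos: "0 < N" and e_pos: "0 < e"
  using n_eq n_pos by auto

lemma z_nz [simp]: "z \<noteq> 0"
  using root_iff[of n] n_pos by (cases "z = 0") (auto simp: zero_power)

lemma zk_nz: "z ^ k \<noteq> 0"
  using z_nz by simp

lemma root_iff_int: "z powi i = 1 \<longleftrightarrow> int n dvd i"
proof (cases "i \<ge> 0")
  case True
  then show ?thesis using root_iff[of "nat i"] by (simp add: power_int_def nat_dvd_iff int_dvd_int_iff[symmetric])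
next
  case False
  then have "z powi i = inverse (z ^ nat (- i))" by (simp add: power_int_def power_inverse)
  then show ?thesis using root_iff[of "nat (- i)"] False
    by (simp add: int_dvd_int_iff[symmetric])
qed

lemma root_sum:
  assumes "int e dvd i"
  shows "(\<Sum>k<N. (z ^ k) powi i) = (if int n dvd i then of_nat N else 0)"
proof -
  have pw: "(z ^ k) powi i = (z powi i) ^ k" for k
    by (simp add: power_int_mult mult.commute flip: power_int_of_nat power_int_mult)
  have "(z powi i) ^ N = z powi (i * int N)"
    by (simp add: power_int_mult)
  also have "\<dots> = 1"
  proof -
    obtain q where "i = int e * q" using assms by auto
    then have "i * int N = int n * q" by (simp add: n_eq)
    then show ?thesis by (simp add: root_iff_int)
  qed
  finally have "(z powi i) ^ N = 1" .
  then show ?thesis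
    using root_iff_int[of i] by (auto simp: pw geometric_sum)
qed

definition conjugate :: "nat \<Rightarrow> complex fps" where
  "conjugate k = rotp (z ^ k) psi"

lemma conj_0: "conjugate 0 = psi"
  by (simp add: conjugate_def fps_eq_iff)

lemma conj_N: "conjugate N = psi"
proof -
  have "(z ^ N) ^ i = 1" if "psi $ i \<noteq> 0" for i
    using psi_supp[OF that] root_iff[of "N * i"] by (auto simp: n_eq power_mult)
  then show ?thesis by (auto simp: conjugate_def fps_eq_iff)
qed

lemma rotp_conj: "rotp (z ^ k) (conjugate l) = conjugate (k + l)"
  by (simp add: conjugate_def fps_eq_iff power_add power_mult_distrib)

lemma conj_neq:
  assumes "k < l" "l < N"
  shows "conjugate k \<noteq> conjugate l"
proof
  assume "conjugate k = conjugate l"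
  moreover have "conjugate l = rotp (z ^ k) (conjugate (l - k))" using assms by (simp add: rotp_conj)
  moreover have "conjugate k = rotp (z ^ k) psi" by (simp add: conjugate_def)
  ultimately have "(z ^ k) ^ i * psi $ i = (z ^ k) ^ i * conjugate (l - k) $ i" for i
    by (metis rotp_nth)
  then have "psi = conjugate (l - k)"
    by (simp add: fps_eq_iff)
  then show False
    using psi_conj[of "l - k"] assms unfolding conjugate_def by (metis less_imp_diff_less zero_less_diff)
qed

lemma conj_inj: "inj_on conjugate {..<N}"
  by (metis conj_neq inj_onI lessThan_iff linorder_neqE_nat)

lemma rotp_coeff:
  assumes "coeffs_in_power n A"
  shows "rotp (z ^ k) (coeff A i) = coeff A i"
proof -
  have "(z ^ k) ^ m = 1" if "coeff A i $ m \<noteq> 0" for m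
    using that assms root_iff[of "k * m"] by (auto simp: coeffs_in_power_def power_mult)
  then show ?thesis by (auto simp: fps_eq_iff)
qed

lemma coeffs_in_powerI:
  assumes "\<And>i. rotp z (coeff A i) = coeff A i"
  shows "coeffs_in_power n A"
  unfolding coeffs_in_power_def
proof (intro allI impI)
  fix i m assume "coeff A i $ m \<noteq> 0"
  then show "n dvd m" using assms[of i] root_iff[of m] by (auto simp: fps_eq_iff)
qed

lemma rotp_eval:
  "coeffs_in_power n A \<Longrightarrow> rotp (z ^ k) (poly A y) = poly A (rotp (z ^ k) y)"
  by (simp add: rotp_poly rotp_coeff)

lemma rotp_eval_conj:
  "coeffs_in_power n A \<Longrightarrow> rotp (z ^ k) (poly A psi) = poly A (conjugate k)"
  by (simp add: rotp_eval conjugate_def)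

lemma rotp_pullback:
  assumes "coeffs_in_power n A" "coeffs_in_power n B"
  shows "rotp (z ^ k) (form_pullback n A B psi) = form_pullback n A B (conjugate k)"
proof -
  have "rotp (z ^ k) (of_nat n * fps_X ^ n) = of_nat n * fps_X ^ n"
    using root_iff[of "k * n"]
    by (auto simp: fps_eq_iff power_mult fps_X_power_iff simp flip: fps_of_nat)
  then show ?thesis
    using assms by (simp add: form_pullback_def rotp_add rotp_mult rotp_euler rotp_eval conjugate_def)
qed

section \<open>Laurent series in t^e and their trace to C((x))\<close>

definition supported :: "complex fls \<Rightarrow> bool" where
  "supported f \<longleftrightarrow> (\<forall>i. f $$ i \<noteq> 0 \<longrightarrow> int e dvd i)"

text \<open>A condition on the support becomes invariance under a ring automorphism, and closure
  under products and quotients is immediate.\<close>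

lemma supported_iff: "supported f \<longleftrightarrow> rot (z ^ N) f = f"
proof -
  have "(z ^ N) powi i = 1 \<longleftrightarrow> int e dvd i" for i
  proof -
    have "(z ^ N) powi i = z powi (int N * i)"
      by (simp add: power_int_mult flip: power_int_of_nat)
    then show ?thesis
      using root_iff_int[of "int N * i"] N_pos by (simp add: n_eq)
  qed
  then show ?thesis by (auto simp: supported_def fls_eq_iff)
qed

lemma supported_mult: "supported f \<Longrightarrow> supported g \<Longrightarrow> supported (f * g)"
  by (simp add: supported_iff rot_mult)

lemma supported_divide: "supported f \<Longrightarrow> supported g \<Longrightarrow> supported (f / g)"
  by (simp add: supported_iff rot_divide)

lemma supported_eval: "coeffs_in_power n A \<Longrightarrow> supported (fps_to_fls (poly A psi))"
  by (simp add: supported_iff rot_fps_to_fls rotp_eval_conj conj_N)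

lemma supported_pullback:
  "coeffs_in_power n A \<Longrightarrow> coeffs_in_power n B \<Longrightarrow> supported (fps_to_fls (form_pullback n A B psi))"
  by (simp add: supported_iff rot_fps_to_fls rotp_pullback conj_N)

text \<open>The sum is the trace from C((t^e)) to C((x)). Up to the factor N it preserves the
  coefficient at 0, which is the residue of f dt/t.\<close>

lemma trace_nth:
  assumes "supported f"
  shows "(\<Sum>k<N. rot (z ^ k) f) $$ i = (if int n dvd i then of_nat N * f $$ i else 0)"
proof (cases "int e dvd i")
  case True
  then show ?thesis
    using root_sum[of i] by (simp add: fls_nth_sum flip: sum_distrib_right)
next
  case False
  then have "f $$ i = 0" "\<not> int n dvd i"
    using assms by (auto simp: supported_def n_eq)
  then show ?thesis by (simp add: fls_nth_sum)
qed

section \<open>The minimal polynomial and trace duality\<close>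

definition min_poly :: "complex fps poly" where
  "min_poly = (\<Prod>k<N. [:- conjugate k, 1:])"

text \<open>Rotation by \<open>z\<close> sends each conjugate to the next and the last one to
  \<open>psi\<close>, so it only permutes the linear factors.\<close>

lemma coeffs_min_poly: "coeffs_in_power n min_poly"
proof (rule coeffs_in_powerI)
  define R where "R = map_poly (rotp z)"
  have c: "coeff (R p) i = rotp z (coeff p i)" for p i
    by (simp add: R_def coeff_map_poly fps_eq_iff)
  have sm: "rotp z (sum f K) = (\<Sum>k\<in>K. rotp z (f k))" for f :: "nat \<Rightarrow> complex fps" and K
    by (simp add: rotp_def fps_compose_sum_distrib)
  have m: "R (p * q) = R p * R q" for p q
    by (simp add: poly_eq_iff c coeff_mult sm rotp_mult)
  have "R (\<Prod>k\<in>K. f k) = (\<Prod>k\<in>K. R (f k))" if "finite K" for K :: "nat set" and f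
    using that
  proof (induction K)
    case empty
    show ?case by (auto simp: poly_eq_iff c coeff_1 fps_eq_iff)
  qed (simp add: m)
  moreover have "R [:- conjugate k, 1:] = [:- conjugate (Suc k), 1:]" for k
    using rotp_conj[of 1 k]
    by (auto simp: poly_eq_iff c coeff_pCons fps_eq_iff split: nat.split)
  ultimately have "R min_poly = (\<Prod>k<N. [:- conjugate (Suc k), 1:])"
    by (simp add: min_poly_def)
  also have "\<dots> = min_poly"
    unfolding min_poly_def by (rule prod_lessThan_shift_cyclic) (simp add: conj_0 conj_N)
  finally show "rotp z (coeff min_poly i) = coeff min_poly i" for i
    by (metis c)
qed

lemma poly_min_poly: "poly min_poly y = (\<Prod>k<N. y - conjugate k)"
  by (simp add: min_poly_def poly_prod)

lemma poly_pderiv_min_poly: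
  assumes "k < N"
  shows "poly (pderiv min_poly) (conjugate k) = (\<Prod>l\<in>{..<N} - {k}. conjugate k - conjugate l)"
proof -
  have "min_poly = [:- conjugate k, 1:] * (\<Prod>l\<in>{..<N} - {k}. [:- conjugate l, 1:])"
    unfolding min_poly_def using assms by (subst prod.remove[of _ k]) auto
  then show ?thesis
    by (simp only: pderiv_mult poly_add poly_mult poly_prod) (simp add: pderiv_pCons)
qed

lemma coeffs_pderiv: "coeffs_in_power n A \<Longrightarrow> coeffs_in_power n (pderiv A)"
  by (auto simp: coeffs_in_power_def coeff_pderiv simp flip: fps_of_nat)

text \<open>The generator f'(psi) of the different of C[[x]][psi]. Its conjugates are the
  denominators of the divided differences at the conjugates of \<open>psi\<close>.\<close>

definition diff_psi :: "complex fls" where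
  "diff_psi = fps_to_fls (poly (pderiv min_poly) psi)"

lemma supported_diff_psi: "supported diff_psi"
  by (simp add: diff_psi_def supported_eval coeffs_pderiv coeffs_min_poly)

lemma fps_to_fls_prod: "fps_to_fls (prod f K) = (\<Prod>k\<in>K. fps_to_fls (f k))" for f :: "nat \<Rightarrow> complex fps"
  by (induction K rule: infinite_finite_induct) (simp_all add: fls_times_fps_to_fls)

lemma rot_diff_psi:
  assumes "k < N"
  shows "rot (z ^ k) diff_psi = (\<Prod>l\<in>{..<N} - {k}. fps_to_fls (conjugate k - conjugate l))"
  using assms
  by (simp add: diff_psi_def rot_fps_to_fls rotp_eval_conj coeffs_pderiv coeffs_min_poly
      poly_pderiv_min_poly fps_to_fls_prod del: fps_to_fls_minus)

text \<open>Without the factor t^n the trace is a divided difference at the conjugates, hence a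
  power series. The factor t^n then clears the coefficient at 0.\<close>

lemma trace_dual:
  assumes "coeffs_in_power n G1" "coeffs_in_power n G2"
  shows "(fps_to_fls (poly (G1 * G2) psi * fps_X ^ n) / diff_psi) $$ 0 = 0"
proof -
  define f where "f = fps_to_fls (poly (G1 * G2) psi * fps_X ^ n) / diff_psi"
  have X: "rotp (z ^ k) (fps_X ^ n) = fps_X ^ n" for k
    using root_iff[of "k * n"] by (auto simp: fps_eq_iff power_mult fps_X_power_iff)
  have rf: "rot (z ^ k) f = fps_to_fls (fps_X ^ n) *
    (fps_to_fls (poly (G1 * G2) (conjugate k)) / (\<Prod>l\<in>{..<N} - {k}. fps_to_fls (conjugate k - conjugate l)))"
    if "k < N" for k
    unfolding f_def rot_divide[OF zk_nz] rot_diff_psi[OF that] rot_fps_to_fls[OF zk_nz]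
    using assms
    by (simp add: rotp_mult X rotp_eval_conj fls_times_fps_to_fls del: fps_to_fls_minus)
  have "supported f"
  proof -
    have "supported (fps_to_fls (poly (G1 * G2) psi * fps_X ^ n))"
      using assms by (simp add: supported_iff rot_fps_to_fls rotp_mult X rotp_eval_conj conj_N)
    then show ?thesis unfolding f_def using supported_diff_psi by (rule supported_divide)
  qed
  then have "of_nat N * f $$ 0 = (\<Sum>k<N. rot (z ^ k) f) $$ 0"
    by (simp add: trace_nth)
  also have "(\<Sum>k<N. rot (z ^ k) f) = fps_to_fls (fps_X ^ n) * divdiff {..<N} conjugate (G1 * G2)"
    by (simp add: rf divdiff_def sum_distrib_left del: fps_to_fls_minus)
  also obtain r where "divdiff {..<N} conjugate (G1 * G2) = fps_to_fls r"
    using divdiff_integral[of "{..<N}" conjugate "G1 * G2"] conj_inj N_pos by auto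
  also have "(fps_to_fls (fps_X ^ n) * fps_to_fls r) $$ 0 = 0"
    using n_pos by (simp flip: fls_times_fps_to_fls)
  finally show ?thesis using N_pos by (simp add: f_def)
qed

text \<open>The residue of omega / \<open>min_poly\<close> along y = psi, for omega = A dx + B
  dy.\<close>

definition residue_part :: "complex fps poly \<Rightarrow> complex fls" where
  "residue_part B = fps_to_fls (poly B psi) / diff_psi"

lemma supported_residue_part: "coeffs_in_power n B \<Longrightarrow> supported (residue_part B)"
  by (simp add: residue_part_def supported_divide supported_eval supported_diff_psi)

text \<open>The difference of the two products is \<open>(B * A' - B' * A) dx\<close> divided by the \<open>y\<close>-derivative of the
  minimal polynomial, and such forms have integral trace.\<close>

lemma isotropy:
  assumes "coeffs_in_power n A" "coeffs_in_power n B" "coeffs_in_power n A'" "coeffs_in_power n B'"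
  shows "(residue_part B * fps_to_fls (form_pullback n A' B' psi)) $$ 0
       = (residue_part B' * fps_to_fls (form_pullback n A B psi)) $$ 0"
proof -
  \<comment> \<open>The terms with \<open>euler psi\<close> occur in both products and
    cancel.\<close>
  have "residue_part B * fps_to_fls (form_pullback n A' B' psi) - residue_part B' * fps_to_fls (form_pullback n A B psi)
     = of_nat n * (fps_to_fls (poly (B * A') psi * fps_X ^ n) / diff_psi)
       - of_nat n * (fps_to_fls (poly (B' * A) psi * fps_X ^ n) / diff_psi)"
    by (simp add: residue_part_def form_pullback_def fls_times_fps_to_fls fps_to_fls_of_nat
        divide_inverse algebra_simps)
  then have "(residue_part B * fps_to_fls (form_pullback n A' B' psi)
      - residue_part B' * fps_to_fls (form_pullback n A B psi)) $$ 0 = 0"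
    using assms trace_dual[of B A'] trace_dual[of B' A]
    by (simp only: fls_minus_nth fls_mult_of_nat_nth) simp
  then show ?thesis by simp
qed

end

section \<open>Values of forms on a branch close to the truncation\<close>

text \<open>The series \<open>y\<close> is the branch itself or its next truncation; \<open>kap\<close> is its contact order with
  the conjugates of \<open>psi\<close>.\<close>

locale contact_family = conjugate_family +
  fixes y :: "complex fps" and kap :: "nat \<Rightarrow> nat" and bbar :: nat
  assumes contact_vanish: "\<And>k i. k < N \<Longrightarrow> i < kap k \<Longrightarrow> (y - conjugate k) $ i = 0"
    and contact_nz: "\<And>k. k < N \<Longrightarrow> (y - conjugate k) $ kap k \<noteq> 0"
    and kap_less: "\<And>k. 0 < k \<Longrightarrow> k < N \<Longrightarrow> kap k < kap 0"
    and character_sum: "\<And>i. int e dvd i \<Longrightarrow> (\<Sum>k<N. of_nat (kap k) * (z ^ k) powi i) \<noteq> (0::complex)"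
    and bbar_eq: "bbar = (\<Sum>k<N. kap k)"
    and bbar_ndvd: "\<not> e dvd bbar"
begin

definition dist_y :: "nat \<Rightarrow> complex fls" where
  "dist_y k = fps_to_fls (y - conjugate k)"

lemma dist_y:
  assumes "k < N"
  shows "vanish (int (kap k)) (dist_y k)" "dist_y k $$ int (kap k) \<noteq> 0" "dist_y k \<noteq> 0"
proof -
  show "vanish (int (kap k)) (dist_y k)"
    using contact_vanish[OF assms] by (auto simp: vanish_def dist_y_def)
  show "dist_y k $$ int (kap k) \<noteq> 0"
    using contact_nz[OF assms] by (simp add: dist_y_def)
  then show "dist_y k \<noteq> 0" by auto
qed

text \<open>This is the value of \<open>min_poly\<close> at \<open>y\<close>, seen as a Laurent
  series.\<close>

definition F :: "complex fls" where
  "F = (\<Prod>k<N. dist_y k)"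

lemma F_order: "vanish (int bbar) F" "F $$ int bbar \<noteq> 0" "F \<noteq> 0"
proof -
  have "vanish (\<Sum>k<N. int (kap k)) F \<and> F $$ (\<Sum>k<N. int (kap k)) = (\<Prod>k<N. dist_y k $$ int (kap k))"
    unfolding F_def by (rule vanish_prod) (auto simp: dist_y)
  then show "vanish (int bbar) F" "F $$ int bbar \<noteq> 0"
    by (simp_all add: bbar_eq dist_y)
  then show "F \<noteq> 0" by auto
qed

text \<open>For k > 0 the contact of \<open>psi\<close> with \<open>conjugate k\<close> is that of
  \<open>y\<close>, because \<open>y\<close> agrees with \<open>psi\<close> below
  \<open>kap 0\<close>, which exceeds \<open>kap k\<close>. The product over k > 0 omits just the
  summand \<open>kap 0\<close> of \<open>bbar\<close>.\<close>

lemma diff_psi_order: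
  "vanish (int bbar - int (kap 0)) diff_psi" "diff_psi $$ (int bbar - int (kap 0)) \<noteq> 0" "diff_psi \<noteq> 0"
proof -
  let ?K = "{..<N} - {0}"
  have v: "vanish (int (kap k)) (fps_to_fls (conjugate 0 - conjugate k)) \<and> fps_to_fls (conjugate 0 - conjugate k) $$ int (kap k) \<noteq> 0"
    if "k \<in> ?K" for k
  proof -
    have k: "k < N" "kap k < kap 0" using that kap_less by auto
    have e: "(conjugate 0 - conjugate k) $ i = (y - conjugate k) $ i" if "i < kap 0" for i
      using contact_vanish[OF N_pos that] by simp
    show ?thesis
      using contact_vanish[of k] contact_nz[of k] k e
      by (auto simp: vanish_def simp del: fps_sub_nth fps_to_fls_minus)
  qed
  have d: "diff_psi = (\<Prod>k\<in>?K. fps_to_fls (conjugate 0 - conjugate k))"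
    using rot_diff_psi[of 0] N_pos by (simp add: fls_eq_iff del: fps_to_fls_minus)
  have "int bbar - int (kap 0) = (\<Sum>k\<in>?K. int (kap k))"
    using N_pos by (simp add: bbar_eq sum.remove[of "{..<N}" 0])
  moreover have "vanish (\<Sum>k\<in>?K. int (kap k)) diff_psi \<and>
    diff_psi $$ (\<Sum>k\<in>?K. int (kap k)) = (\<Prod>k\<in>?K. fps_to_fls (conjugate 0 - conjugate k) $$ int (kap k))"
    unfolding d by (rule vanish_prod) (use v in auto)
  moreover have "(\<Prod>k\<in>?K. fps_to_fls (conjugate 0 - conjugate k) $$ int (kap k)) \<noteq> 0"
    using v by (simp del: fls_minus_nth fps_to_fls_minus)
  ultimately show "vanish (int bbar - int (kap 0)) diff_psi" "diff_psi $$ (int bbar - int (kap 0)) \<noteq> 0"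
    by simp_all
  then show "diff_psi \<noteq> 0" by auto
qed

definition log_sum :: "complex fls \<Rightarrow> complex fls" where
  "log_sum b = (\<Sum>k<N. rot (z ^ k) b * (fps_to_fls (euler (y - conjugate k)) / dist_y k))"

lemma vanish_rot: "vanish s b \<Longrightarrow> vanish s (rot (z ^ k) b)"
  by (simp add: vanish_def)

text \<open>Under t d/dt the logarithmic derivative of a series of order \<open>kap k\<close> has
  constant term \<open>kap k\<close>, so the leading coefficients add up to a character sum.\<close>

lemma log_sum_order:
  assumes b: "vanish s b"
  shows "vanish s (log_sum b)"
    "log_sum b $$ s = b $$ s * (\<Sum>k<N. of_nat (kap k) * (z ^ k) powi s)"
proof -
  have *: "vanish s (rot (z ^ k) b * (fps_to_fls (euler (y - conjugate k)) / dist_y k)) \<and>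
    (rot (z ^ k) b * (fps_to_fls (euler (y - conjugate k)) / dist_y k)) $$ s
       = b $$ s * (of_nat (kap k) * (z ^ k) powi s)" if "k < N" for k
  proof -
    have "vanish (int (kap k)) (fps_to_fls (euler (y - conjugate k)))"
      using contact_vanish[OF that] by (auto simp: vanish_def)
    from vanish_divide[OF this dist_y(1,2)[OF that]]
    have 1: "vanish 0 (fps_to_fls (euler (y - conjugate k)) / dist_y k)"
      "(fps_to_fls (euler (y - conjugate k)) / dist_y k) $$ 0 = of_nat (kap k)"
      using dist_y(2)[OF that] by (simp_all add: dist_y_def)
    show ?thesis
      using vanish_mult[OF vanish_rot[OF b] 1(1), of k] 1(2) by simp
  qed
  show "vanish s (log_sum b)"
    unfolding log_sum_def by (rule vanish_sum) (use * in auto)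
  show "log_sum b $$ s = b $$ s * (\<Sum>k<N. of_nat (kap k) * (z ^ k) powi s)"
    using * by (simp add: log_sum_def fls_nth_sum sum_distrib_left)
qed

definition pole_sum :: "complex fls \<Rightarrow> complex fls" where
  "pole_sum c = (\<Sum>k<N. rot (z ^ k) c / dist_y k)"

text \<open>Only the term with k = 0 reaches the lowest order, since its contact is strictly the
  largest; hence nothing cancels.\<close>

lemma pole_sum_order:
  assumes c: "vanish s c"
  shows "vanish (s - int (kap 0)) (pole_sum c)"
    "pole_sum c $$ (s - int (kap 0)) = c $$ s / dist_y 0 $$ int (kap 0)"
proof -
  have *: "vanish (s - int (kap k)) (rot (z ^ k) c / dist_y k) \<and>
    (rot (z ^ k) c / dist_y k) $$ (s - int (kap k)) = rot (z ^ k) c $$ s / dist_y k $$ int (kap k)"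
    if "k < N" for k
    using vanish_divide[OF vanish_rot[OF c] dist_y(1,2)[OF that], of k] by blast
  have 0: "(rot (z ^ k) c / dist_y k) $$ (s - int (kap 0)) = 0" if "k \<in> {..<N} - {0}" for k
    using * that kap_less[of k] by (auto simp: vanish_def)
  have split: "pole_sum c = rot (z ^ 0) c / dist_y 0 + (\<Sum>k\<in>{..<N} - {0}. rot (z ^ k) c / dist_y k)"
    unfolding pole_sum_def using N_pos by (subst sum.remove[of _ 0]) auto
  have "vanish (s - int (kap 0)) (rot (z ^ k) c / dist_y k)" if "k < N" for k
    by (rule vanish_mono[OF conjunct1[OF *[OF that]]])
       (use that kap_less[of k] in \<open>cases "k = 0"; force\<close>)
  then show "vanish (s - int (kap 0)) (pole_sum c)"
    unfolding pole_sum_def by (intro vanish_sum) auto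
  show "pole_sum c $$ (s - int (kap 0)) = c $$ s / dist_y 0 $$ int (kap 0)"
    using *[OF N_pos] 0 by (simp add: split fls_nth_sum)
qed

lemma y_neq_conj: "k < N \<Longrightarrow> y \<noteq> conjugate k"
  using dist_y(3)[of k] by (auto simp: dist_y_def)

text \<open>The divided difference of \<open>G\<close> at \<open>y\<close> and all conjugates is a
  power series. Solving for the term of \<open>y\<close> gives the partial fraction expansion with
  integral remainder.\<close>

lemma eval_decomposition:
  "\<exists>r. fps_to_fls (poly G y) = F * (fps_to_fls r
      + (\<Sum>k<N. fps_to_fls (poly G (conjugate k)) / (rot (z ^ k) diff_psi * dist_y k)))"
proof -
  \<comment> \<open>The index \<open>N\<close>, free among the conjugates, carries the extra node
    \<open>y\<close>.\<close>
  define c where "c = (\<lambda>i. if i = N then y else conjugate i)"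
  have cN: "c N = y" and ck: "\<And>k. k < N \<Longrightarrow> c k = conjugate k"
    by (auto simp: c_def)
  have "inj_on c {..N}"
  proof (rule inj_onI)
    fix i j assume ij: "i \<in> {..N}" "j \<in> {..N}" "c i = c j"
    then show "i = j"
      using y_neq_conj[of i] y_neq_conj[of j] inj_onD[OF conj_inj, of i j]
      by (auto simp: c_def le_less split: if_splits)
  qed
  then obtain r where r: "divdiff {..N} c G = fps_to_fls r"
    using divdiff_integral[of "{..N}" c G] by auto
  have N: "fps_to_fls (poly G (c N)) / (\<Prod>l\<in>{..N} - {N}. fps_to_fls (c N - c l)) = fps_to_fls (poly G y) / F"
  proof -
    have "{..N} - {N} = {..<N}" by auto
    then show ?thesis by (simp add: F_def dist_y_def cN ck del: fps_to_fls_minus)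
  qed
  have k: "fps_to_fls (poly G (c k)) / (\<Prod>l\<in>{..N} - {k}. fps_to_fls (c k - c l))
      = - (fps_to_fls (poly G (conjugate k)) / (rot (z ^ k) diff_psi * dist_y k))" if "k < N" for k
  proof -
    have "{..N} - {k} = insert N ({..<N} - {k})" using that by auto
    moreover have "fps_to_fls (conjugate k - y) = - dist_y k" by (simp add: dist_y_def)
    ultimately have "(\<Prod>l\<in>{..N} - {k}. fps_to_fls (c k - c l)) = - dist_y k * rot (z ^ k) diff_psi"
      using that by (simp add: cN ck rot_diff_psi del: fps_to_fls_minus)
    then show ?thesis using that by (simp add: ck mult.commute)
  qed
  have "{..N} = insert N {..<N}" by auto
  then have "divdiff {..N} c G = fps_to_fls (poly G y) / F
     - (\<Sum>k<N. fps_to_fls (poly G (conjugate k)) / (rot (z ^ k) diff_psi * dist_y k))"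
    unfolding divdiff_def using N k by (simp add: sum_negf del: fps_to_fls_minus)
  then have "fps_to_fls (poly G y) / F = fps_to_fls r
     + (\<Sum>k<N. fps_to_fls (poly G (conjugate k)) / (rot (z ^ k) diff_psi * dist_y k))"
    using r by (simp add: algebra_simps)
  then show ?thesis using F_order(3) by (intro exI[of _ r]) (simp add: field_simps)
qed

text \<open>In the partial fractions of \<open>A\<close> and \<open>B\<close>,
  \<open>euler y\<close> is split as euler (y - psi_k) + euler psi_k. The first summand gives
  \<open>log_sum\<close>; the second joins the dx-term to the pullback to psi_k and gives
  \<open>pole_sum\<close>.\<close>

lemma pullback_decomposition:
  assumes A: "coeffs_in_power n A" and B: "coeffs_in_power n B"
  shows "\<exists>r. vanish 1 r \<and> fps_to_fls (form_pullback n A B y) =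
     F * (r + (log_sum (residue_part B) + pole_sum (fps_to_fls (form_pullback n A B psi) / diff_psi)))"
proof -
  define X where "X = fps_to_fls (of_nat n * fps_X ^ n :: complex fps)"
  define E where "E = fps_to_fls (euler y)"
  obtain rA where rA: "fps_to_fls (poly A y) = F * (fps_to_fls rA
      + (\<Sum>k<N. fps_to_fls (poly A (conjugate k)) / (rot (z ^ k) diff_psi * dist_y k)))"
    using eval_decomposition by blast
  obtain rB where rB: "fps_to_fls (poly B y) = F * (fps_to_fls rB
      + (\<Sum>k<N. fps_to_fls (poly B (conjugate k)) / (rot (z ^ k) diff_psi * dist_y k)))"
    using eval_decomposition by blast
  define r where "r = fps_to_fls (rA * (of_nat n * fps_X ^ n) + rB * euler y)"
  have "vanish 1 r"
  proof -
    have "(rA * (of_nat n * fps_X ^ n) + rB * euler y) $ 0 = 0"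
      using n_pos by simp
    then show ?thesis by (auto simp: vanish_def r_def nat_eq_iff2 simp del: fps_to_fls_plus)
  qed
  have "rot (z ^ k) (residue_part B) * (fps_to_fls (euler (y - conjugate k)) / dist_y k)
      + rot (z ^ k) (fps_to_fls (form_pullback n A B psi) / diff_psi) / dist_y k
      = fps_to_fls (poly A (conjugate k)) / (rot (z ^ k) diff_psi * dist_y k) * X
      + fps_to_fls (poly B (conjugate k)) / (rot (z ^ k) diff_psi * dist_y k) * E" if "k < N" for k
  proof -
    have b: "rot (z ^ k) (residue_part B) = fps_to_fls (poly B (conjugate k)) / rot (z ^ k) diff_psi"
      using B by (simp add: residue_part_def rot_divide rot_fps_to_fls rotp_eval_conj)
    have p: "rot (z ^ k) (fps_to_fls (form_pullback n A B psi) / diff_psi)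
      = (fps_to_fls (poly A (conjugate k)) * X + fps_to_fls (poly B (conjugate k)) * fps_to_fls (euler (conjugate k)))
        / rot (z ^ k) diff_psi"
      using A B by (simp only: rot_divide[OF zk_nz] rot_fps_to_fls[OF zk_nz] rotp_pullback)
        (simp add: form_pullback_def fls_times_fps_to_fls X_def)
    have e: "fps_to_fls (euler (y - conjugate k)) = E - fps_to_fls (euler (conjugate k))"
      by (simp add: E_def euler_diff)
    show ?thesis unfolding b p e
      by (simp only: divide_inverse inverse_mult_distrib algebra_simps)
  qed
  then have "log_sum (residue_part B) + pole_sum (fps_to_fls (form_pullback n A B psi) / diff_psi)
     = (\<Sum>k<N. fps_to_fls (poly A (conjugate k)) / (rot (z ^ k) diff_psi * dist_y k)) * X
     + (\<Sum>k<N. fps_to_fls (poly B (conjugate k)) / (rot (z ^ k) diff_psi * dist_y k)) * E"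
    by (simp add: log_sum_def pole_sum_def sum_distrib_right flip: sum.distrib)
  note sums = this
  have r: "r = fps_to_fls rA * X + fps_to_fls rB * E"
    by (simp add: r_def X_def E_def fls_times_fps_to_fls)
  have "fps_to_fls (form_pullback n A B y) = fps_to_fls (poly A y) * X + fps_to_fls (poly B y) * E"
    by (simp add: form_pullback_def X_def E_def fls_times_fps_to_fls)
  also have "\<dots> = F * (r + (log_sum (residue_part B) + pole_sum (fps_to_fls (form_pullback n A B psi) / diff_psi)))"
    unfolding r rA rB sums by (simp only: distrib_left distrib_right mult_ac add_ac)
  finally have "fps_to_fls (form_pullback n A B y) =
     F * (r + (log_sum (residue_part B) + pole_sum (fps_to_fls (form_pullback n A B psi) / diff_psi)))" .
  with \<open>vanish 1 r\<close> show ?thesis by blast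
qed

text \<open>\<open>log_sum\<close> has order ord b, a multiple of e, and \<open>pole_sum\<close> has
  order ord p - bbar, which is none. The two never cancel, and the smaller order is m -
  bbar.\<close>

lemma small_order_cases:
  assumes A: "coeffs_in_power n A" and B: "coeffs_in_power n B"
    and nz: "form_pullback n A B y \<noteq> 0" and m_def: "m = subdegree (form_pullback n A B y)" and le: "m \<le> bbar"
  defines "p \<equiv> fps_to_fls (form_pullback n A B psi)" and "b \<equiv> residue_part B"
  shows "vanish (int m) p \<and> vanish (int m - int bbar) b \<and>
    (p $$ int m \<noteq> 0 \<and> b $$ (int m - int bbar) = 0 \<and> e dvd m \<or>
     p $$ int m = 0 \<and> b $$ (int m - int bbar) \<noteq> 0 \<and> int e dvd int m - int bbar)"
proof -
  define q where "q = int m - int bbar"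
  define W where "W = log_sum b + pole_sum (p / diff_psi)"
  obtain r where r: "vanish 1 r" and eq: "fps_to_fls (form_pullback n A B y) = F * (r + W)"
    using pullback_decomposition[OF A B] unfolding W_def p_def b_def by blast
  have "vanish (int m) (fps_to_fls (form_pullback n A B y))"
    by (auto simp: vanish_def m_def nat_less_iff intro: nth_less_subdegree_zero)
  from vanish_divide[OF this F_order(1,2)]
  have "vanish q (r + W)" "(r + W) $$ q \<noteq> 0"
    using nz F_order(2,3) by (simp_all add: eq q_def[symmetric]) (metis eq m_def fps_to_fls_nth nat_int nth_subdegree_nonzero of_nat_0_le_iff verit_comp_simplify1(3))
  \<comment> \<open>The remainder \<open>r\<close> begins at order 1 and cannot influence the
    coefficient at \<open>q\<close>.\<close>
  moreover have "q < 1" using le by (simp add: q_def)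
  ultimately have W: "vanish q W" "W $$ q \<noteq> 0"
    using r by (auto simp: vanish_def)
  have sb: "supported b" unfolding b_def by (rule supported_residue_part[OF B])
  have sp: "supported p" unfolding p_def by (rule supported_pullback[OF A B])
  have Wq: "q = s" if "vanish s W" "W $$ s \<noteq> 0" for s
    using that W by (meson linorder_less_linear vanishD)
  have L: "vanish s (log_sum b)" "log_sum b $$ s \<noteq> 0" if "vanish s b" "b $$ s \<noteq> 0" for s
    using log_sum_order[OF that(1)] that(2) character_sum[of s] sb by (auto simp: supported_def)
  \<comment> \<open>Division by \<open>diff_psi\<close> costs \<open>bbar - kap 0\<close> and the
    pole at the nearest conjugate costs \<open>kap 0\<close>, together \<open>bbar\<close>.\<close>
  have P: "vanish (t - int bbar) (pole_sum (p / diff_psi))"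
    "p $$ t \<noteq> 0 \<Longrightarrow> pole_sum (p / diff_psi) $$ (t - int bbar) \<noteq> 0" if "vanish t p" for t
    using vanish_divide[OF that diff_psi_order(1,2)] diff_psi_order(2) dist_y(2)[OF N_pos]
      pole_sum_order[of "t - (int bbar - int (kap 0))" "p / diff_psi"] by auto
  define s where "s = fls_subdegree b"
  define t where "t = fls_subdegree p"
  have vb: "vanish s b" and vp: "vanish t p" by (simp_all add: s_def t_def)
  have bs: "b $$ s \<noteq> 0" "int e dvd s" if "b \<noteq> 0"
    using that sb by (auto simp: s_def supported_def)
  have pt: "p $$ t \<noteq> 0" "int e dvd t" if "p \<noteq> 0"
    using that sp by (auto simp: t_def supported_def)
  have b0: "log_sum b = 0" if "b = 0" using that by (simp add: log_sum_def rot_def)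
  have p0: "pole_sum (p / diff_psi) = 0" if "p = 0" using that by (simp add: pole_sum_def rot_def)
  have "\<not> int e dvd int bbar" using bbar_ndvd by simp
  then have ne: "s \<noteq> t - int bbar" if "b \<noteq> 0" "p \<noteq> 0"
    using bs(2) pt(2) that by (metis diff_diff_eq2 add_diff_cancel_left' dvd_diff)
  consider (1) "b \<noteq> 0" "p = 0 \<or> s < t - int bbar" | (2) "p \<noteq> 0" "b = 0 \<or> t - int bbar < s"
    using W(2) b0 p0 ne unfolding W_def by force
  then show ?thesis
  proof cases
    case 1
    have "vanish (s + 1) (pole_sum (p / diff_psi))"
      using 1(2) p0 vanish_mono[OF P(1)[OF vp]] by auto
    then have "vanish s W \<and> W $$ s \<noteq> 0"
      unfolding W_def using L[OF vb bs(1)[OF 1(1)]] by (simp add: vanish_def)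
    then have q: "q = s" using Wq by blast
    then have "vanish (int m + 1) p" using 1(2) vanish_mono[OF vp] by (auto simp: q_def)
    then show ?thesis
      using q bs 1(1) vb by (auto simp: q_def vanish_def)
  next
    case 2
    have "vanish (t - int bbar + 1) (log_sum b)"
      using 2(2) b0 vanish_mono[OF log_sum_order(1)[OF vb]] by auto
    then have "vanish (t - int bbar) W \<and> W $$ (t - int bbar) \<noteq> 0"
      unfolding W_def using P[OF vp] pt(1)[OF 2(1)] by (simp add: vanish_def)
    then have q: "q = t - int bbar" using Wq by blast
    then have t: "t = int m" by (simp add: q_def)
    have "vanish (q + 1) b" using 2(2) q vanish_mono[OF vb] by auto
    then show ?thesis
      using q pt 2(1) vp t by (auto simp: q_def vanish_def)
  qed
qed

end

section \<open>Logarithmic forms\<close>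

context contact_family
begin

text \<open>Membership in C[[x]]: no polar part, and invariance under the generator of the Galois
  group.\<close>

definition integral_inv :: "complex fls \<Rightarrow> bool" where
  "integral_inv f \<longleftrightarrow> (\<exists>g. f = fps_to_fls g \<and> rotp z g = g)"

lemma integral_inv_0: "integral_inv 0"
  unfolding integral_inv_def by (rule exI[of _ 0]) (simp add: fps_eq_iff)

lemma integral_inv_add: "integral_inv f \<Longrightarrow> integral_inv g \<Longrightarrow> integral_inv (f + g)"
  unfolding integral_inv_def by (metis fps_to_fls_plus rotp_add)

lemma integral_inv_mult: "integral_inv f \<Longrightarrow> integral_inv g \<Longrightarrow> integral_inv (f * g)"
  unfolding integral_inv_def by (metis fls_times_fps_to_fls rotp_mult)

lemma integral_inv_coeff_min_poly: "integral_inv (fps_to_fls (coeff min_poly i))"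
  using rotp_coeff[OF coeffs_min_poly, of 1 i] by (auto simp: integral_inv_def)

lemma supported_power: "supported f \<Longrightarrow> supported (f ^ r)"
  by (induction r) (auto simp: supported_mult, simp add: supported_def)

lemma supported_psi: "supported (fps_to_fls psi)"
  by (simp add: supported_iff rot_fps_to_fls conjugate_def[symmetric] conj_N)

text \<open>The polynomial is the sum of g_k f / (Y - psi_k), with f = \<open>min_poly\<close>. Its
  coefficients are C[[x]]-combinations of traces of g psi^r, and \<open>dual\<close> says that these
  traces have no polar part.\<close>

lemma poly_conj_combination:
  assumes g: "supported g"
    and dual: "\<And>q r. (g * fps_to_fls (fps_X ^ (n * Suc q) * psi ^ r)) $$ 0 = 0"
  shows "\<exists>G. coeffs_in_power n G \<and> fps_to_fls (poly G y) = F * pole_sum g"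
proof -
  define Q where "Q k = synthetic_div min_poly (conjugate k)" for k
  have root: "poly min_poly (conjugate k) = 0" if "k < N" for k
    using that by (auto simp: poly_min_poly)
  have fac: "min_poly = [:- conjugate k, 1:] * Q k" if "k < N" for k
    using synthetic_div_correct'[of "conjugate k" min_poly] root[OF that] by (simp add: Q_def)
  have rec: "coeff (Q k) i = coeff min_poly (Suc i) + conjugate k * coeff (Q k) (Suc i)" if "k < N" for k i
    by (subst fac[OF that]) simp
  have deg: "coeff (Q k) i = 0" if "degree min_poly \<le> i" "k < N" for k i
    using that
  proof (cases "degree min_poly = 0")
    case True
    then have "Q k = 0" by (simp add: Q_def synthetic_div_eq_0_iff)
    then show ?thesis by simp
  next
    case False
    then show ?thesis using that
      by (intro coeff_eq_0) (simp add: Q_def degree_synthetic_div)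
  qed
  define T where "T r i = (\<Sum>k<N. rot (z ^ k) g * fps_to_fls (conjugate k ^ r * coeff (Q k) i))" for r i
  have trace: "integral_inv (\<Sum>k<N. rot (z ^ k) g * fps_to_fls (conjugate k ^ r))" for r
  proof -
    define h where "h = g * fps_to_fls (psi ^ r)"
    have h: "supported h"
      unfolding h_def fps_to_fls_power using supported_mult[OF g supported_power[OF supported_psi]] .
    have "rotp (z ^ k) (psi ^ r) = conjugate k ^ r" for k
      by (simp add: conjugate_def rotp_def fps_compose_power)
    then have "(\<Sum>k<N. rot (z ^ k) g * fps_to_fls (conjugate k ^ r)) = (\<Sum>k<N. rot (z ^ k) h)"
      by (simp add: h_def rot_mult rot_fps_to_fls)
    moreover have "integral_inv (\<Sum>k<N. rot (z ^ k) h)"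
    proof -
      define f where "f = (\<Sum>k<N. rot (z ^ k) h)"
      have neg: "f $$ i = 0" if "i < 0" for i
      proof (cases "int n dvd i")
        case True
        \<comment> \<open>With this \<open>j\<close> one has i = -n (j + 1), so the coefficient of
          \<open>h\<close> at \<open>i\<close> is the pairing of \<open>g\<close> with x^(j+1)
          psi^r.\<close>
        define j where "j = nat (- i div int n) - 1"
        have "i = - int (n * Suc j)"
        proof -
          obtain c where c: "i = int n * c" using True by auto
          then have "c < 0" using that n_pos by (simp add: mult_less_0_iff)
          moreover have "- i div int n = - c"
            using c n_pos by (simp flip: mult_minus_right)
          ultimately show ?thesis using c by (simp add: j_def algebra_simps)
        qed
        moreover have "g * fps_to_fls (fps_X ^ (n * Suc j) * psi ^ r) = fls_X ^ (n * Suc j) * h"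
          by (simp add: h_def fls_times_fps_to_fls fps_to_fls_power algebra_simps del: mult_Suc_right)
        ultimately have "h $$ i = 0"
          using dual[of j r] by (simp add: fls_X_power_times_conv_shift)
        then show ?thesis using trace_nth[OF h] by (simp add: f_def)
      qed (simp add: f_def trace_nth[OF h])
      then have "fps_to_fls (fls_regpart f) = f"
        by (intro fls_eqI) (simp add: fls_eq_iff)
      moreover have "rotp z (fls_regpart f) = fls_regpart f"
        using trace_nth[OF h] root_iff by (auto simp: fps_eq_iff f_def int_dvd_int_iff)
      ultimately show ?thesis
        unfolding f_def[symmetric] integral_inv_def by metis
    qed
    ultimately show ?thesis by simp
  qed
  have T: "integral_inv (T r i)" for r i
  \<comment> \<open>Descending induction from the degree, where the quotients \<open>Q k\<close>
    have no coefficients left. Each use of \<open>rec\<close> raises the power of psi_k by one, so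
    \<open>r\<close> stays arbitrary.\<close>
  proof (induction "degree min_poly - i" arbitrary: i r)
    case 0
    then have "T r i = 0" by (simp add: T_def deg)
    then show ?case by (simp add: integral_inv_0)
  next
    case (Suc x)
    have "T r i = fps_to_fls (coeff min_poly (Suc i)) * (\<Sum>k<N. rot (z ^ k) g * fps_to_fls (conjugate k ^ r)) + T (Suc r) (Suc i)"
      unfolding T_def sum_distrib_left sum.distrib[symmetric]
      by (intro sum.cong refl, subst rec) (simp_all add: fls_times_fps_to_fls algebra_simps)
    then show ?case
      using Suc trace integral_inv_coeff_min_poly by (auto intro!: integral_inv_add integral_inv_mult)
  qed
  define G where "G = (\<Sum>i\<le>degree min_poly. monom (fls_regpart (T 0 i)) i)"
  have Tr: "fps_to_fls (fls_regpart (T 0 i)) = T 0 i" "rotp z (fls_regpart (T 0 i)) = fls_regpart (T 0 i)" for i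
    using T[of 0 i] by (auto simp: integral_inv_def)
  have "coeffs_in_power n G"
  proof (rule coeffs_in_powerI)
    fix i
    have "coeff G i = (if i \<le> degree min_poly then fls_regpart (T 0 i) else 0)"
      by (simp add: G_def coeff_sum)
    moreover have "rotp z 0 = 0" by (simp add: fps_eq_iff)
    ultimately show "rotp z (coeff G i) = coeff G i" by (simp add: Tr)
  qed
  moreover have "fps_to_fls (poly G y) = F * pole_sum g"
  proof -
    have sumf: "fps_to_fls (sum f K) = (\<Sum>k\<in>K. fps_to_fls (f k))" for f :: "nat \<Rightarrow> complex fps" and K
      by (induction K rule: infinite_finite_induct) auto
    have "fps_to_fls (poly G y) = (\<Sum>i\<le>degree min_poly. T 0 i * fps_to_fls (y ^ i))"
      by (simp add: G_def poly_sum poly_monom sumf fls_times_fps_to_fls Tr)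
    also have "\<dots> = (\<Sum>k<N. rot (z ^ k) g * fps_to_fls (\<Sum>i\<le>degree min_poly. coeff (Q k) i * y ^ i))"
      unfolding T_def sum_distrib_right sumf sum_distrib_left
      by (subst sum.swap) (simp add: fls_times_fps_to_fls algebra_simps)
    also have "\<dots> = (\<Sum>k<N. rot (z ^ k) g * fps_to_fls (poly (Q k) y))"
    proof (intro sum.cong refl)
      fix k assume "k \<in> {..<N}"
      have "degree (Q k) \<le> degree min_poly" by (simp add: Q_def degree_synthetic_div)
      then have "poly (Q k) y = (\<Sum>i\<le>degree min_poly. coeff (Q k) i * y ^ i)"
        by (metis (no_types, lifting) poly_as_sum_of_monoms' poly_monom poly_sum sum.cong)
      then show "rot (z ^ k) g * fps_to_fls (\<Sum>i\<le>degree min_poly. coeff (Q k) i * y ^ i)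
        = rot (z ^ k) g * fps_to_fls (poly (Q k) y)" by simp
    qed
    also have "\<dots> = (\<Sum>k<N. F * (rot (z ^ k) g / dist_y k))"
    proof (intro sum.cong refl)
      fix k assume k: "k \<in> {..<N}"
      have "F = fps_to_fls (poly min_poly y)"
        by (simp add: F_def dist_y_def poly_min_poly fps_to_fls_prod del: fps_to_fls_minus)
      also have "\<dots> = dist_y k * fps_to_fls (poly (Q k) y)"
        using k by (subst fac[of k]) (auto simp: dist_y_def fls_times_fps_to_fls[symmetric] left_diff_distrib simp del: fps_to_fls_minus)
      finally show "rot (z ^ k) g * fps_to_fls (poly (Q k) y) = F * (rot (z ^ k) g / dist_y k)"
        using dist_y(3) k by simp
    qed
    also have "\<dots> = F * pole_sum g" by (simp add: pole_sum_def sum_distrib_left)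
    finally show ?thesis .
  qed
  ultimately show ?thesis by blast
qed

text \<open>The logarithmic form \<open>f * (\<Sum>k. b k * d(y - psi k) / (y - psi k))\<close>.\<close>

lemma log_form_exists:
  assumes b: "supported b" "vanish s b" "b $$ s \<noteq> 0"
    and dual: "\<And>A B. coeffs_in_power n A \<Longrightarrow> coeffs_in_power n B \<Longrightarrow>
       (b * fps_to_fls (form_pullback n A B psi)) $$ 0 = 0"
  shows "\<exists>A B. coeffs_in_power n A \<and> coeffs_in_power n B \<and> form_pullback n A B y \<noteq> 0 \<and>
      int (subdegree (form_pullback n A B y)) = int bbar + s"
proof -
  define X where "X = fps_to_fls (of_nat n * fps_X ^ n :: complex fps)"
  have X_nz: "X \<noteq> 0" using n_pos by (simp add: X_def)
  have Xn: "X = of_nat n * fps_to_fls (fps_X ^ n)"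
    by (simp add: X_def fls_times_fps_to_fls fps_to_fls_of_nat)
  have rotX: "rot (z ^ k) X = X" for k
    using root_iff[of "k * n"]
    by (auto simp: X_def rot_fps_to_fls fps_eq_iff power_mult fps_X_power_iff simp flip: fps_of_nat)
  \<comment> \<open>The dx-coefficient of b (dy - dpsi): in terms of dt/t, dpsi is
    \<open>euler psi\<close> and dx is \<open>X\<close>.\<close>
  define g where "g = - (b * fps_to_fls (euler psi)) / X"
  have mono: "coeffs_in_power n (monom (fps_X ^ (n * q)) r)" for q r
    by (auto simp: coeffs_in_power_def fps_X_power_iff split: if_splits)
  have zero: "coeffs_in_power n 0" by (simp add: coeffs_in_power_def)
  \<comment> \<open>Testing \<open>dual\<close> on the forms x^q y^r dx gives the pairing condition
    for \<open>b\<close>; the forms x^q y^r dy will give the one for \<open>g\<close>.\<close>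
  have "\<exists>B. coeffs_in_power n B \<and> fps_to_fls (poly B y) = F * pole_sum b"
  proof (rule poly_conj_combination[OF b(1)])
    fix q r
    have "b * fps_to_fls (form_pullback n (monom (fps_X ^ (n * q)) r) 0 psi)
       = of_nat n * (b * fps_to_fls (fps_X ^ (n * Suc q) * psi ^ r))"
      by (simp add: form_pullback_def poly_monom fls_times_fps_to_fls fps_to_fls_of_nat power_add algebra_simps)
    then show "(b * fps_to_fls (fps_X ^ (n * Suc q) * psi ^ r)) $$ 0 = 0"
      using dual[OF mono zero, of q r] n_pos by (simp only: fls_mult_of_nat_nth) simp
  qed
  then obtain B where B: "coeffs_in_power n B" "fps_to_fls (poly B y) = F * pole_sum b" by blast
  have "\<exists>A. coeffs_in_power n A \<and> fps_to_fls (poly A y) = F * pole_sum g"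
  proof (rule poly_conj_combination)
    have "supported X" by (simp add: supported_iff rotX)
    moreover have "supported (fps_to_fls (euler psi))"
      unfolding supported_def
    proof (intro allI impI)
      fix i assume "fps_to_fls (euler psi) $$ i \<noteq> 0"
      then have "i \<ge> 0" "psi $ nat i \<noteq> 0" by (auto split: if_splits)
      then show "int e dvd i" using psi_supp[of "nat i"] by (metis int_dvd_int_iff nat_0_le)
    qed
    ultimately have "supported X" "supported (fps_to_fls (euler psi))" by blast+
    then have "supported (b * fps_to_fls (euler psi) / X)"
      using b(1) by (simp add: supported_mult supported_divide)
    then show "supported g" by (simp add: g_def supported_def)
    fix q r
    have "of_nat n * (g * fps_to_fls (fps_X ^ (n * Suc q) * psi ^ r))
       = - (b * fps_to_fls (form_pullback n 0 (monom (fps_X ^ (n * q)) r) psi)) * (X / X)"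
      unfolding g_def divide_inverse
      by (simp add: form_pullback_def poly_monom fls_times_fps_to_fls Xn power_add algebra_simps)
    then have "of_nat n * (g * fps_to_fls (fps_X ^ (n * Suc q) * psi ^ r))
       = - (b * fps_to_fls (form_pullback n 0 (monom (fps_X ^ (n * q)) r) psi))"
      using X_nz by simp
    then have "(of_nat n * (g * fps_to_fls (fps_X ^ (n * Suc q) * psi ^ r))) $$ 0 = 0"
      using dual[OF zero mono, of q r] by (simp only: fls_uminus_nth) simp
    then show "(g * fps_to_fls (fps_X ^ (n * Suc q) * psi ^ r)) $$ 0 = 0"
      using n_pos by (simp only: fls_mult_of_nat_nth) simp
  qed
  then obtain A where A: "coeffs_in_power n A" "fps_to_fls (poly A y) = F * pole_sum g" by blast
  have "rot (z ^ k) g / dist_y k * X + rot (z ^ k) b / dist_y k * fps_to_fls (euler y)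
     = rot (z ^ k) b * (fps_to_fls (euler (y - conjugate k)) / dist_y k)" for k
  proof -
    have "rot (z ^ k) g = - (rot (z ^ k) b * fps_to_fls (euler (conjugate k))) / X"
    proof -
      have "rot (z ^ k) (- f) = - rot (z ^ k) f" for f by (simp add: fls_eq_iff)
      then show ?thesis
        by (simp add: g_def rot_divide rot_mult rot_fps_to_fls rotX rotp_euler conjugate_def)
    qed
    then have "rot (z ^ k) g * X = - (rot (z ^ k) b * fps_to_fls (euler (conjugate k)))"
      using X_nz by simp
    moreover have "rot (z ^ k) g / dist_y k * X = (rot (z ^ k) g * X) / dist_y k" by simp
    ultimately show ?thesis
      by (simp add: euler_diff divide_inverse algebra_simps)
  qed
  then have "pole_sum g * X + pole_sum b * fps_to_fls (euler y) = log_sum b"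
    unfolding pole_sum_def log_sum_def by (simp add: sum_distrib_right flip: sum.distrib)
  note sums = this
  have "fps_to_fls (form_pullback n A B y) = fps_to_fls (poly A y) * X + fps_to_fls (poly B y) * fps_to_fls (euler y)"
    by (simp add: form_pullback_def X_def fls_times_fps_to_fls)
  also have "\<dots> = F * (pole_sum g * X + pole_sum b * fps_to_fls (euler y))"
    unfolding A(2) B(2) by (simp only: distrib_left mult.assoc)
  finally have W: "fps_to_fls (form_pullback n A B y) = F * log_sum b"
    unfolding sums .
  have "int e dvd s" using b by (simp add: supported_def)
  then have "log_sum b $$ s \<noteq> 0"
    using log_sum_order(2)[OF b(2)] b(3) character_sum by simp
  then have "vanish (int bbar + s) (F * log_sum b)" "(F * log_sum b) $$ (int bbar + s) \<noteq> 0"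
    using vanish_mult[OF F_order(1) log_sum_order(1)[OF b(2)]] F_order(2) by auto
  then have "fls_subdegree (F * log_sum b) = int bbar + s" "F * log_sum b \<noteq> 0"
    by (auto intro!: fls_subdegree_eqI simp: vanish_def)
  then show ?thesis
    using A B W by (metis fls_subdegree_fls_to_fps fps_to_fls_eq_0_iff)
qed

end

text \<open>By \<open>none\<close> the projection of \<open>U\<close> to the coordinates 0 to
  \<open>M\<close> contains no nonzero multiple of the last unit vector, so some functional kills it
  and is 1 on that vector. The induction splits off coordinate 0.\<close>

lemma annihilating_functional:
  fixes U :: "(nat \<Rightarrow> complex) set"
  assumes add: "\<And>u v. u \<in> U \<Longrightarrow> v \<in> U \<Longrightarrow> (\<lambda>i. u i + v i) \<in> U"
    and scale: "\<And>c u. u \<in> U \<Longrightarrow> (\<lambda>i. c * u i) \<in> U"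
    and none: "\<And>u. u \<in> U \<Longrightarrow> (\<And>i. i < M \<Longrightarrow> u i = 0) \<Longrightarrow> u M = 0"
  shows "\<exists>c. c M = 1 \<and> (\<forall>u\<in>U. (\<Sum>i\<le>M. c i * u i) = 0)"
  using assms
proof (induction M arbitrary: U)
  case 0
  then show ?case by (intro exI[of _ "\<lambda>_. 1"]) auto
next
  case (Suc M)
  define V where "V = {\<lambda>i. u (Suc i) | u. u \<in> U \<and> u 0 = 0}"
  have "\<exists>c. c M = 1 \<and> (\<forall>u\<in>V. (\<Sum>i\<le>M. c i * u i) = 0)"
  proof (rule Suc.IH)
    fix u v assume "u \<in> V" "v \<in> V"
    then obtain u' v' where *: "u = (\<lambda>i. u' (Suc i))" "v = (\<lambda>i. v' (Suc i))"
      "u' \<in> U" "v' \<in> U" "u' 0 = 0" "v' 0 = 0" by (auto simp: V_def)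
    show "(\<lambda>i. u i + v i) \<in> V"
      unfolding V_def using * Suc.prems(1)[of u' v'] by (intro CollectI exI[of _ "\<lambda>i. u' i + v' i"]) auto
  next
    fix c u assume "u \<in> V"
    then obtain u' where *: "u = (\<lambda>i. u' (Suc i))" "u' \<in> U" "u' 0 = 0" by (auto simp: V_def)
    show "(\<lambda>i. c * u i) \<in> V"
      unfolding V_def using * Suc.prems(2)[of u' c] by (intro CollectI exI[of _ "\<lambda>i. c * u' i"]) auto
  next
    fix u assume u: "u \<in> V" "\<And>i. i < M \<Longrightarrow> u i = 0"
    then obtain u' where *: "u = (\<lambda>i. u' (Suc i))" "u' \<in> U" "u' 0 = 0" by (auto simp: V_def)
    have "u' i = 0" if "i < Suc M" for i
      using that u(2) * by (cases i) auto
    then show "u M = 0" using Suc.prems(3)[of u'] * by simp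
  qed
  then obtain c where c: "c M = 1" "\<And>u. u \<in> V \<Longrightarrow> (\<Sum>i\<le>M. c i * u i) = 0" by blast
  have ker: "(\<Sum>i\<le>M. c i * u (Suc i)) = 0" if "u \<in> U" "u 0 = 0" for u
    using c(2)[of "\<lambda>i. u (Suc i)"] that by (auto simp: V_def)
  show ?case
  proof (cases "\<exists>w\<in>U. w 0 \<noteq> 0")
    case True
    then obtain w where w: "w \<in> U" "w 0 \<noteq> 0" by blast
    \<comment> \<open>This value kills \<open>w\<close>. Every other \<open>u\<close> is a multiple
      of \<open>w\<close> plus an element vanishing at 0, to which \<open>ker\<close>
      applies.\<close>
    define d where "d = - (\<Sum>i\<le>M. c i * w (Suc i)) / w 0"
    have "d * u 0 + (\<Sum>i\<le>M. c i * u (Suc i)) = 0" if "u \<in> U" for u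
    proof -
      have "(\<Sum>i\<le>M. c i * (u (Suc i) + - (u 0 / w 0) * w (Suc i))) = 0"
        using ker[OF Suc.prems(1)[OF that Suc.prems(2)[OF w(1), of "- (u 0 / w 0)"]]] w(2) by simp
      then have "(\<Sum>i\<le>M. c i * u (Suc i)) = (u 0 / w 0) * (\<Sum>i\<le>M. c i * w (Suc i))"
        by (simp add: algebra_simps sum_subtractf sum.distrib sum_negf sum_distrib_left)
      then show ?thesis by (simp add: d_def)
    qed
    then show ?thesis
      using c(1) by (intro exI[of _ "case_nat d c"]) (simp add: sum.atMost_Suc_shift del: sum.atMost_Suc)
  next
    case False
    then show ?thesis
      using c(1) ker by (intro exI[of _ "case_nat 0 c"]) (simp add: sum.atMost_Suc_shift del: sum.atMost_Suc)
  qed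
qed

section \<open>Characteristic exponents and contact orders\<close>

lemma power_powi: "(w ^ q) powi i = (w powi i) ^ q" for w :: "'a::field"
  by (metis mult.commute power_int_mult power_int_of_nat)

lemma unit_root_power_eq_1_iff:
  assumes "0 < n"
  shows "exp (2 * of_real pi * \<i> / of_nat n) ^ m = 1 \<longleftrightarrow> n dvd m"
proof -
  have "exp (2 * of_real pi * \<i> / of_nat n) ^ m = exp (2 * of_real pi * \<i> * of_nat m / of_nat n)"
    by (simp add: field_simps flip: exp_of_nat_mult)
  then show ?thesis using complex_root_unity_eq_1[of n m] assms by simp
qed

locale puiseux_branch =
  fixes n :: nat and a :: "nat \<Rightarrow> complex"
  assumes sing: "n \<ge> 2"
    and prim: "\<forall>d::nat. d dvd n \<and> (\<forall>k. a k \<noteq> 0 \<longrightarrow> d dvd k) \<longrightarrow> d = 1"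
begin

abbreviation "e \<equiv> puiseux_e n a"
abbreviation "be \<equiv> puiseux_beta n a"
abbreviation "bb \<equiv> puiseux_betabar n a"
abbreviation "g \<equiv> puiseux_g n a"

lemma e_Suc: "e (Suc j) = gcd (e j) (be (Suc j))"
  by (simp add: puiseux_beta_def)

lemma e_dvd_n: "e j dvd n"
  by (induction j) (auto intro: gcd_dvdI1)

lemma e_pos: "0 < e j"
  using e_dvd_n[of j] sing by (auto intro: Nat.gr0I)

lemma e_dvd: "l \<le> j \<Longrightarrow> e j dvd e l"
  by (induction rule: dec_induct) (auto intro: gcd_dvdI1)

lemma e_neq_1: "j < g \<Longrightarrow> e j \<noteq> 1"
  unfolding puiseux_g_def by (rule not_less_Least)

text \<open>For j < g, \<open>e j\<close> is a divisor of n other than 1, so by \<open>prim\<close>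
  some exponent is not a multiple of it, and the least such exponent exists.\<close>

lemma be_Suc:
  assumes "j < g"
  shows "a (be (Suc j)) \<noteq> 0" "\<not> e j dvd be (Suc j)" "\<And>i. i < be (Suc j) \<Longrightarrow> a i \<noteq> 0 \<Longrightarrow> e j dvd i"
proof -
  have "\<exists>k. a k \<noteq> 0 \<and> \<not> e j dvd k"
    using prim e_neq_1[OF assms] e_dvd_n by blast
  from LeastI_ex[OF this] show "a (be (Suc j)) \<noteq> 0" "\<not> e j dvd be (Suc j)"
    by (simp_all add: puiseux_beta_def)
  show "e j dvd i" if "i < be (Suc j)" "a i \<noteq> 0" for i
    using not_less_Least[of i "\<lambda>k. a k \<noteq> 0 \<and> \<not> e j dvd k"] that by (auto simp: puiseux_beta_def)
qed

lemma be_less: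
  assumes "Suc j < g"
  shows "be (Suc j) < be (Suc (Suc j))"
proof -
  have "e (Suc j) dvd be (Suc j)" unfolding e_Suc by simp
  then have "be (Suc j) \<noteq> be (Suc (Suc j))"
    using be_Suc(2)[OF assms] by metis
  moreover have "\<not> be (Suc (Suc j)) < be (Suc j)"
    using be_Suc[OF assms] be_Suc(3)[of j "be (Suc (Suc j))"] assms e_dvd[of j "Suc j"] dvd_trans
    by (metis Suc_lessD le_add2 plus_1_eq_Suc)
  ultimately show ?thesis by simp
qed

text \<open>The case distinction is needed because \<open>puiseux_beta n a 0\<close> is \<open>\<beta>\<^sub>1\<close> and not \<open>0\<close>.\<close>

definition gap :: "nat \<Rightarrow> nat" where
  "gap l = be (Suc l) - (if l = 0 then 0 else be l)"

lemma sum_gap: "L < g \<Longrightarrow> (\<Sum>l\<le>L. gap l) = be (Suc L)"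
proof (induction L)
  case (Suc L)
  then show ?case using be_less[of L] by (simp add: gap_def)
qed (simp add: gap_def)

lemma gap_pos: "l < g \<Longrightarrow> 0 < gap l"
  using be_less[of "l - 1"] be_Suc(2)[of 0] by (cases l) (auto simp: gap_def intro: Nat.gr0I)

text \<open>The recursion unrolled. This form is a sum of contact orders: each \<open>gap l\<close>
  is shared by \<open>e l div e j\<close> conjugates.\<close>

lemma betabar_sum: "j < g \<Longrightarrow> bb (Suc j) = (\<Sum>l\<le>j. gap l * (e l div e j))"
proof (induction j)
  case 0
  then show ?case using e_pos[of 0] by (simp add: gap_def)
next
  case (Suc j)
  have "(e j div e (Suc j)) * bb (Suc j) = (\<Sum>l\<le>j. gap l * (e l div e (Suc j)))"
  proof -
    have "(e j div e (Suc j)) * (e l div e j) = e l div e (Suc j)" if "l \<le> j" for l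
      using div_mult_div_if_dvd[OF e_dvd[of j "Suc j"] e_dvd[OF that]] e_pos[of j]
      by (simp add: mult.commute del: puiseux_e.simps)
    then show ?thesis
      using Suc by (simp add: sum_distrib_left mult.left_commute del: puiseux_e.simps puiseux_betabar.simps)
  qed
  moreover have "bb (Suc (Suc j)) = (e j div e (Suc j)) * bb (Suc j) + be (Suc (Suc j)) - be (Suc j)"
    by (simp del: puiseux_e.simps)
  moreover have "gap (Suc j) = be (Suc (Suc j)) - be (Suc j)" by (simp add: gap_def)
  ultimately show ?case
    using be_less[OF Suc.prems] e_pos[of "Suc j"] by (simp del: puiseux_e.simps puiseux_betabar.simps)
qed

lemma e_dvd_be: "e (Suc j) dvd be (Suc j)"
  unfolding e_Suc by simp

text \<open>Modulo \<open>e (Suc j)\<close> the next betabar is the difference of two consecutive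
  betas, of which only the smaller is divisible.\<close>

lemma betabar_divisibility:
  "j < g \<Longrightarrow> e (Suc j) dvd bb (Suc j) \<and> \<not> e j dvd bb (Suc j)"
proof (induction j)
  case 0
  then show ?case using be_Suc(2)[of 0] e_dvd_be[of 0] by (simp del: puiseux_e.simps(2))
next
  case (Suc j)
  define d where "d = be (Suc (Suc j)) - be (Suc j)"
  have be: "be (Suc (Suc j)) = be (Suc j) + d" using be_less[OF Suc.prems] by (simp add: d_def)
  then have bb: "bb (Suc (Suc j)) = (e j div e (Suc j)) * bb (Suc j) + d"
    by (simp del: puiseux_e.simps)
  have 1: "e (Suc j) dvd bb (Suc j)" using Suc by simp
  have 2: "e (Suc (Suc j)) dvd e (Suc j)" using e_dvd[of "Suc j" "Suc (Suc j)"] by simp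
  have "\<not> e (Suc j) dvd d"
    using be_Suc(2)[OF Suc.prems] e_dvd_be[of j] be by (metis dvd_add)
  moreover have "e (Suc (Suc j)) dvd d"
    using e_dvd_be[of "Suc j"] dvd_trans[OF 2 e_dvd_be[of j]] be by (metis dvd_add_right_iff)
  ultimately show ?case
    unfolding bb using 1 2 by (meson dvd_add dvd_add_right_iff dvd_mult dvd_trans)
qed

lemmas e_dvd_betabar = betabar_divisibility[THEN conjunct1]
  and e_ndvd_betabar = betabar_divisibility[THEN conjunct2]

text \<open>The contact order with the k-th conjugate of the truncation below
  \<open>be (Suc j)\<close>. \<open>gap l\<close> counts when rotation by z^k fixes t^(e_l). As a
  sum over levels it lets character sums be computed level by level.\<close>

definition kap :: "nat \<Rightarrow> nat \<Rightarrow> nat" where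
  "kap j k = (\<Sum>l\<le>j. if n dvd k * e l then gap l else 0)"

definition trunc :: "nat \<Rightarrow> complex fps" where
  "trunc b = Abs_fps (\<lambda>i. if i < b then a i else 0)"

abbreviation "z \<equiv> exp (2 * of_real pi * \<i> / of_nat n)"

lemma z_root: "z ^ m = 1 \<longleftrightarrow> n dvd m"
  using unit_root_power_eq_1_iff sing by simp

text \<open>Divisibility at level \<open>L\<close> implies it at all lower levels, so the levels
  that count form an initial segment and their gaps telescope.\<close>

lemma kap_eq:
  assumes "j < g"
  obtains L where "L \<le> j" "kap j k = be (Suc L)" "n dvd k * e L" "L < j \<Longrightarrow> \<not> n dvd k * e (Suc L)"
proof -
  define S where "S = {l. l \<le> j \<and> n dvd k * e l}"
  have fin: "finite S" and "0 \<in> S" by (auto simp: S_def)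
  define L where "L = Max S"
  have L: "L \<in> S" unfolding L_def using fin \<open>0 \<in> S\<close> by (intro Max_in) auto
  have S: "S = {..L}"
  proof
    show "S \<subseteq> {..L}" using fin by (auto simp: L_def)
    show "{..L} \<subseteq> S"
    proof
      fix l assume "l \<in> {..L}"
      then have "k * e L dvd k * e l" using e_dvd by (auto intro: mult_dvd_mono)
      then show "l \<in> S" using L \<open>l \<in> {..L}\<close> by (auto simp: S_def intro: dvd_trans)
    qed
  qed
  have "kap j k = (\<Sum>l\<in>S. gap l)"
    unfolding kap_def by (subst sum.inter_filter[symmetric]) (auto simp: S_def)
  then have "kap j k = be (Suc L)"
  proof -
    have "L < g" using L assms by (simp add: S_def)
    then show "kap j k = sum gap S \<Longrightarrow> kap j k = be (Suc L)" by (simp add: S sum_gap)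
  qed
  moreover have "\<not> n dvd k * e (Suc L)" if "L < j"
  proof
    assume "n dvd k * e (Suc L)"
    then have "Suc L \<in> S" using that by (simp add: S_def del: puiseux_e.simps)
    then show False using S by simp
  qed
  ultimately show ?thesis using L that by (auto simp: S_def)
qed

lemma kap_0: "j < g \<Longrightarrow> kap j 0 = be (Suc j)"
  by (simp add: kap_def sum_gap)

lemma be_strict: "l < j \<Longrightarrow> j < g \<Longrightarrow> be (Suc l) < be (Suc j)"
proof (induction j)
  case (Suc j)
  then show ?case using be_less[of j] by (cases "l = j") auto
qed simp

lemma kap_less:
  assumes "j < g" "0 < k" "k < n div e j"
  shows "kap j k < kap j 0"
proof -
  obtain L where L: "L \<le> j" "kap j k = be (Suc L)" "n dvd k * e L" using kap_eq[OF assms(1)] by blast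
  have "L \<noteq> j"
  proof
    assume "L = j"
    then have "n dvd k * e j" using L by simp
    moreover have "k * e j < n"
      using assms(3) e_dvd_n[of j] e_pos[of j] by (metis dvd_div_mult_self mult_less_cancel2)
    ultimately show False using assms(2) e_pos[of j] by (auto dest: dvd_imp_le)
  qed
  then show ?thesis using L be_strict[of L j] assms(1) by (simp add: kap_0)
qed

text \<open>Exponents below \<open>be (Suc L)\<close> are multiples of \<open>e L\<close>, hence
  fixed by z^k. If the term at \<open>be (Suc L)\<close> were fixed too, n would divide k gcd(e_L,
  beta) = k e_(L+1).\<close>

lemma contact:
  assumes j: "j < g" and y: "\<And>i. i \<le> be (Suc j) \<Longrightarrow> y $ i = a i" and k: "k < n div e j"
  shows "i < kap j k \<Longrightarrow> (y - rotp (z ^ k) (trunc (be (Suc j)))) $ i = 0"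
    and "(y - rotp (z ^ k) (trunc (be (Suc j)))) $ kap j k \<noteq> 0"
proof -
  obtain L where L: "L \<le> j" "kap j k = be (Suc L)" "n dvd k * e L" "L < j \<Longrightarrow> \<not> n dvd k * e (Suc L)"
    using kap_eq[OF j] by blast
  have Lg: "L < g" using L j by simp
  have le: "be (Suc L) \<le> be (Suc j)" using be_strict[of L j] L j by (cases "L = j") auto
  have coeff: "(y - rotp (z ^ k) (trunc (be (Suc j)))) $ i = a i - z ^ (k * i) * a i" if "i < be (Suc j)" for i
    using that y[of i] by (simp add: trunc_def power_mult)
  show "(y - rotp (z ^ k) (trunc (be (Suc j)))) $ i = 0" if "i < kap j k"
  proof -
    have i: "i < be (Suc L)" using that L by simp
    have "a i = 0 \<or> z ^ (k * i) = 1"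
    proof (cases "a i = 0")
      case False
      then have "k * e L dvd k * i" using be_Suc(3)[OF Lg i] by simp
      then show ?thesis using L(3) z_root[of "k * i"] dvd_trans by blast
    qed simp
    then show ?thesis using coeff[of i] i le by auto
  qed
  show "(y - rotp (z ^ k) (trunc (be (Suc j)))) $ kap j k \<noteq> 0"
  proof (cases "L = j")
    \<comment> \<open>The truncation stops just before \<open>be (Suc j)\<close>, so only
      \<open>y\<close> contributes this coefficient.\<close>
    case True
    then show ?thesis
      using L y[of "be (Suc j)"] be_Suc(1)[OF j] by (simp add: trunc_def)
  next
    case False
    then have "L < j" using L by simp
    have "k * e (Suc L) = gcd (k * e L) (k * be (Suc L))"
      by (simp add: e_Suc gcd_mult_distrib_nat del: puiseux_e.simps)
    then have "\<not> n dvd k * be (Suc L)"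
      using L(3) L(4)[OF \<open>L < j\<close>] by (metis gcd_greatest_iff)
    then have "z ^ (k * be (Suc L)) \<noteq> 1" using z_root by blast
    then show ?thesis
      using coeff[of "be (Suc L)"] be_strict[OF \<open>L < j\<close> j] be_Suc(1)[OF Lg] L by simp
  qed
qed

text \<open>The relevant \<open>k\<close> are the multiples of n / e_l, a cyclic group of order e_l
  / e_j on which the summand is a character. The sum is the group order or 0.\<close>

lemma subgroup_character_sum:
  assumes "l \<le> j" "int (e j) dvd i"
  shows "\<exists>c::nat. (\<Sum>k<n div e j. if n dvd k * e l then (z ^ k) powi i else 0) = of_nat c
    \<and> (l = j \<longrightarrow> c = 1) \<and> (i = 0 \<longrightarrow> c = e l div e j)"
proof -
  define h where "h = n div e l"
  define M where "M = e l div e j"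
  have n: "n = h * e l" using e_dvd_n by (simp add: h_def)
  have el: "e l = M * e j" using e_dvd[OF assms(1)] by (simp add: M_def)
  have h: "h > 0" using n sing by (cases h) auto
  have N: "n div e j = h * M" using n el e_pos[of j] by (metis mult.assoc nonzero_mult_div_cancel_right less_numeral_extra(3))
  have iff: "n dvd k * e l \<longleftrightarrow> h dvd k" for k
    by (metis n e_pos[of l] dvd_times_right_cancel_iff less_numeral_extra(3))
  have set: "{k. k < h * M \<and> h dvd k} = (\<lambda>q. h * q) ` {..<M}"
    using h by (auto simp: dvd_def)
  have "(\<Sum>k<n div e j. if n dvd k * e l then (z ^ k) powi i else 0) = (\<Sum>k\<in>{k. k < h * M \<and> h dvd k}. (z ^ k) powi i)"
    unfolding iff N by (subst sum.inter_filter[symmetric]) simp_all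
  also have "\<dots> = (\<Sum>q<M. (z ^ (h * q)) powi i)"
    unfolding set using h by (subst sum.reindex) (auto simp: inj_on_def)
  also have "\<dots> = (\<Sum>q<M. ((z ^ h) powi i) ^ q)"
    unfolding power_mult power_powi ..
  finally have S: "(\<Sum>k<n div e j. if n dvd k * e l then (z ^ k) powi i else 0) = (\<Sum>q<M. ((z ^ h) powi i) ^ q)" .
  have "((z ^ h) powi i) ^ M = 1"
  proof -
    obtain r where r: "i = int (e j) * r" using assms(2) by auto
    have "((z ^ h) powi i) ^ M = (z ^ (h * e j * M)) powi r"
      unfolding r power_int_mult power_int_of_nat power_mult power_powi ..
    also have "z ^ (h * e j * M) = 1" using z_root[of n] n el by (simp add: mult_ac)
    finally show ?thesis by simp
  qed
  then have "(\<Sum>q<M. ((z ^ h) powi i) ^ q) = of_nat (if (z ^ h) powi i = 1 then M else 0)"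
    by (auto simp: geometric_sum)
  moreover have "l = j \<Longrightarrow> M = 1" using e_pos[of j] by (simp add: M_def)
  moreover have "l = j \<Longrightarrow> (\<Sum>q<M. ((z ^ h) powi i) ^ q) = 1" using calculation(2) by simp
  ultimately show ?thesis unfolding S by (cases "l = j") (auto simp: M_def intro!: exI[of _ "if (z ^ h) powi i = 1 then M else 0"])
qed

text \<open>All coefficients are natural numbers and the top one is 1, so the sum is positive. The
  trivial character i = 0 yields the sum of the contact orders.\<close>

lemma kap_character_sum:
  assumes "j < g" "int (e j) dvd i"
  shows "\<exists>c :: nat \<Rightarrow> nat. (\<Sum>k<n div e j. of_nat (kap j k) * (z ^ k) powi i) = (of_nat (\<Sum>l\<le>j. gap l * c l) :: complex)
    \<and> c j = 1 \<and> (i = 0 \<longrightarrow> (\<forall>l\<le>j. c l = e l div e j))"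
proof -
  define P where "P l c \<longleftrightarrow> (\<Sum>k<n div e j. if n dvd k * e l then (z ^ k) powi i else 0) = of_nat c
    \<and> (l = j \<longrightarrow> c = 1) \<and> (i = 0 \<longrightarrow> c = e l div e j)" for l and c :: nat
  have "\<forall>l\<in>{..j}. \<exists>c. P l c"
    using subgroup_character_sum[OF _ assms(2)] by (simp add: P_def)
  from bchoice[OF this] obtain c where "\<And>l. l \<le> j \<Longrightarrow> P l (c l)" by auto
  then have c: "(\<Sum>k<n div e j. if n dvd k * e l then (z ^ k) powi i else 0) = of_nat (c l)"
    "l = j \<Longrightarrow> c l = 1" "i = 0 \<Longrightarrow> c l = e l div e j" if "l \<le> j" for l
    using that unfolding P_def by blast+
  have "(\<Sum>k<n div e j. of_nat (kap j k) * (z ^ k) powi i)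
      = (\<Sum>k<n div e j. \<Sum>l\<le>j. of_nat (gap l) * (if n dvd k * e l then (z ^ k) powi i else 0))"
  proof (rule sum.cong[OF refl])
    fix k
    have "of_nat (kap j k) * w = (\<Sum>l\<le>j. of_nat (gap l) * (if n dvd k * e l then w else 0))" for w :: complex
      unfolding kap_def of_nat_sum sum_distrib_right by (rule sum.cong) auto
    then show "of_nat (kap j k) * (z ^ k) powi i = (\<Sum>l\<le>j. of_nat (gap l) * (if n dvd k * e l then (z ^ k) powi i else 0))" .
  qed
  also have "\<dots> = (\<Sum>l\<le>j. of_nat (gap l) * of_nat (c l))"
    by (subst sum.swap) (rule sum.cong[OF refl], simp only: sum_distrib_left[symmetric] c(1) atMost_iff)
  also have "\<dots> = of_nat (\<Sum>l\<le>j. gap l * c l)" by simp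
  finally show ?thesis using c(2,3) by (intro exI[of _ c]) auto
qed

lemma contact_familyI:
  assumes j: "j < g" and y: "\<And>i. i \<le> be (Suc j) \<Longrightarrow> y $ i = a i"
  shows "contact_family n (e j) (n div e j) z (trunc (be (Suc j))) y (kap j) (bb (Suc j))"
proof -
  have N: "0 < n div e j" using e_dvd_n[of j] sing e_pos[of j] by (simp add: div_greater_zero_iff dvd_imp_le)
  have fam: "conjugate_family n (e j) (n div e j) z (trunc (be (Suc j)))"
  proof
    show "n = n div e j * e j" using e_dvd_n by simp
    show "0 < n" using sing by simp
    show "z ^ m = 1 \<longleftrightarrow> n dvd m" for m by (rule z_root)
    show "e j dvd m" if "trunc (be (Suc j)) $ m \<noteq> 0" for m
      using that be_Suc(3)[OF j] by (auto simp: trunc_def split: if_splits)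
    \<comment> \<open>At \<open>kap j k\<close>, which is less than \<open>kap j 0\<close>,
      \<open>y\<close> agrees with the truncation but not with its conjugate.\<close>
    show "rotp (z ^ k) (trunc (be (Suc j))) \<noteq> trunc (be (Suc j))" if "0 < k" "k < n div e j" for k
    proof
      assume *: "rotp (z ^ k) (trunc (be (Suc j))) = trunc (be (Suc j))"
      have "rotp (z ^ 0) (trunc (be (Suc j))) = trunc (be (Suc j))" by (simp add: fps_eq_iff)
      then show False
        using contact(2)[OF j y that(2)] contact(1)[OF j y N kap_less[OF j that]] * by simp
    qed
  qed
  then interpret conjugate_family n "e j" "n div e j" z "trunc (be (Suc j))" .
  show ?thesis
  proof
    show "(y - conjugate k) $ i = 0" if "k < n div e j" "i < kap j k" for k i
      using contact(1)[OF j y that] by (simp add: conjugate_def)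
    show "(y - conjugate k) $ kap j k \<noteq> 0" if "k < n div e j" for k
      using contact(2)[OF j y that] by (simp add: conjugate_def)
    show "kap j k < kap j 0" if "0 < k" "k < n div e j" for k
      using kap_less[OF j that] .
    show "(\<Sum>k<n div e j. of_nat (kap j k) * (z ^ k) powi i) \<noteq> (0::complex)" if dvd: "int (e j) dvd i" for i
    proof -
      obtain c where c: "(\<Sum>k<n div e j. of_nat (kap j k) * (z ^ k) powi i) = (of_nat (\<Sum>l\<le>j. gap l * c l) :: complex)" "c j = 1"
        using kap_character_sum[OF j dvd] by blast
      have "gap j * c j \<noteq> 0" using gap_pos[OF j] c by simp
      then have "(\<Sum>l\<le>j. gap l * c l) \<noteq> 0" by (metis atMost_iff finite_atMost order_refl sum_eq_0_iff)
      then show ?thesis unfolding c(1) of_nat_eq_0_iff .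
    qed
    show "bb (Suc j) = (\<Sum>k<n div e j. kap j k)"
    proof -
      have "\<exists>c :: nat \<Rightarrow> nat. (\<Sum>k<n div e j. of_nat (kap j k) * (z ^ k) powi 0) = (of_nat (\<Sum>l\<le>j. gap l * c l) :: complex)
          \<and> c j = 1 \<and> ((0::int) = 0 \<longrightarrow> (\<forall>l\<le>j. c l = e l div e j))"
        using j by (rule kap_character_sum) (rule dvd_0_right)
      then obtain c where c: "(\<Sum>k<n div e j. of_nat (kap j k) * (z ^ k) powi 0) = (of_nat (\<Sum>l\<le>j. gap l * c l) :: complex)"
        "\<forall>l\<le>j. c l = e l div e j" by blast
      have "(of_nat (\<Sum>k<n div e j. kap j k) :: complex) = of_nat (\<Sum>l\<le>j. gap l * c l)"
        using c(1) unfolding power_int_0_right mult_1_right of_nat_sum .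
      then show ?thesis using c(2) betabar_sum[OF j] by (simp only: of_nat_eq_iff) simp
    qed
    show "\<not> e j dvd bb (Suc j)" by (rule e_ndvd_betabar[OF j])
  qed
qed

end

section \<open>Passage to the next characteristic exponent\<close>

lemma form_pullback_add:
  "form_pullback n (A + A') (B + B') y = form_pullback n A B y + form_pullback n A' B' y"
  by (simp add: form_pullback_def algebra_simps)

lemma form_pullback_smult:
  "form_pullback n (smult c A) (smult c B) y = c * form_pullback n A B y"
  by (simp add: form_pullback_def algebra_simps)

lemma coeffs_in_power_add:
  "coeffs_in_power n A \<Longrightarrow> coeffs_in_power n B \<Longrightarrow> coeffs_in_power n (A + B)"
  unfolding coeffs_in_power_def by (metis add.right_neutral coeff_add fps_add_nth)

lemma coeffs_in_power_smult:
  "coeffs_in_power n A \<Longrightarrow> coeffs_in_power n (smult (fps_const c) A)"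
  by (auto simp: coeffs_in_power_def)

context puiseux_branch
begin

definition formal_values :: "nat set" where
  "formal_values = {subdegree (form_pullback n A B (Abs_fps a)) | A B.
     coeffs_in_power n A \<and> coeffs_in_power n B \<and> form_pullback n A B (Abs_fps a) \<noteq> 0}"

lemma formal_step:
  assumes m: "m \<in> formal_values" and j: "Suc j < g" and le: "m \<le> bb (Suc j)"
  shows "\<exists>m'\<in>formal_values. int m' = int (bb (Suc (Suc j))) + int m - int (bb (Suc j))"
proof -
  define phi where "phi = Abs_fps a"
  define D where "D = trunc (be (Suc (Suc j)))"
  have jg: "j < g" using j by simp
  \<comment> \<open>\<open>P\<close> compares the branch with psi_j, \<open>Q\<close> the next
    truncation \<open>D\<close> with psi_j, and \<open>R\<close> the branch with
    \<open>D\<close>.\<close>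
  interpret P: contact_family n "e j" "n div e j" z "trunc (be (Suc j))" phi "kap j" "bb (Suc j)"
    by (rule contact_familyI[OF jg]) (simp add: phi_def)
  interpret Q: contact_family n "e j" "n div e j" z "trunc (be (Suc j))" D "kap j" "bb (Suc j)"
    by (rule contact_familyI[OF jg]) (use be_less[OF j] in \<open>simp add: D_def trunc_def\<close>)
  interpret R: contact_family n "e (Suc j)" "n div e (Suc j)" z D phi "kap (Suc j)" "bb (Suc (Suc j))"
    unfolding D_def by (rule contact_familyI[OF j]) (simp add: phi_def)
  define psi where "psi = trunc (be (Suc j))"
  obtain A B where AB: "coeffs_in_power n A" "coeffs_in_power n B" "form_pullback n A B phi \<noteq> 0"
    "m = subdegree (form_pullback n A B phi)"
    using m by (auto simp: formal_values_def phi_def)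
  define p where "p = fps_to_fls (form_pullback n A B psi)"
  define b where "b = P.residue_part B"
  have small: "vanish (int m) p \<and> vanish (int m - int (bb (Suc j))) b \<and>
    (p $$ int m \<noteq> 0 \<and> b $$ (int m - int (bb (Suc j))) = 0 \<and> e j dvd m \<or>
     p $$ int m = 0 \<and> b $$ (int m - int (bb (Suc j))) \<noteq> 0 \<and> int (e j) dvd int m - int (bb (Suc j)))"
    unfolding p_def b_def psi_def by (rule P.small_order_cases[OF AB le])
  define m' where "m' = bb (Suc j) - m"
  have mm: "int m - int (bb (Suc j)) = - int m'" "int (bb (Suc j)) = int m + int m'" "m' \<le> bb (Suc j)"
    using le by (simp_all add: m'_def)
  have ej: "e (Suc j) dvd e j" using e_dvd[of j "Suc j"] by simp
  have "e (Suc j) dvd m'"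
  proof -
    have "e (Suc j) dvd m \<or> e (Suc j) dvd m'"
      using small ej unfolding mm(1) by (metis dvd_minus_iff dvd_trans int_dvd_int_iff)
    moreover have "e (Suc j) dvd m + m'" using e_dvd_betabar[OF jg] le by (simp add: m'_def del: puiseux_e.simps)
    ultimately show ?thesis using dvd_add_right_iff dvd_add_left_iff by blast
  qed
  \<comment> \<open>Isotropy equates the leading coefficients of b p' and b' p. So \<open>m\<close>
    and \<open>m'\<close> both come from pullbacks or both from residues; either way
    \<open>e j\<close> divides both and hence \<open>bb (Suc j)\<close>, which is
    impossible.\<close>
  have no_form: "form_pullback n A' B' D $ m' = 0"
    if AB': "coeffs_in_power n A'" "coeffs_in_power n B'" and low: "\<And>i. i < m' \<Longrightarrow> form_pullback n A' B' D $ i = 0"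
    for A' B'
  proof (rule ccontr)
    assume ne: "form_pullback n A' B' D $ m' \<noteq> 0"
    then have nz: "form_pullback n A' B' D \<noteq> 0" by auto
    have sd: "m' = subdegree (form_pullback n A' B' D)"
      using ne low by (intro subdegreeI[symmetric]) auto
    define p' where "p' = fps_to_fls (form_pullback n A' B' psi)"
    define b' where "b' = P.residue_part B'"
    have small': "vanish (int m') p' \<and> vanish (int m' - int (bb (Suc j))) b' \<and>
      (p' $$ int m' \<noteq> 0 \<and> b' $$ (int m' - int (bb (Suc j))) = 0 \<and> e j dvd m' \<or>
       p' $$ int m' = 0 \<and> b' $$ (int m' - int (bb (Suc j))) \<noteq> 0 \<and> int (e j) dvd int m' - int (bb (Suc j)))"
      unfolding p'_def b'_def psi_def by (rule Q.small_order_cases[OF AB' nz sd mm(3)])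
    have mm': "int m' - int (bb (Suc j)) = - int m" using mm by simp
    have "(b * p') $$ 0 = (b' * p) $$ 0"
      unfolding b_def b'_def p_def p'_def psi_def by (rule P.isotropy[OF AB(1,2) AB'])
    moreover have "(b * p') $$ 0 = b $$ (- int m') * p' $$ int m'"
      using vanish_mult(2)[of "- int m'" b "int m'" p'] small small' mm by simp
    moreover have "(b' * p) $$ 0 = b' $$ (- int m) * p $$ int m"
      using vanish_mult(2)[of "- int m" b' "int m" p] small small' mm' by simp
    ultimately have iso: "b $$ (- int m') * p' $$ int m' = b' $$ (- int m) * p $$ int m" by simp
    have "\<not> e j dvd m + m'" using e_ndvd_betabar[OF jg] le by (simp add: m'_def)
    then have "\<not> (e j dvd m \<and> e j dvd m')" by auto
    then show False
      using small small' iso unfolding mm(1) mm' by auto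
  qed
  define U where "U = {\<lambda>i. form_pullback n A B D $ i | A B. coeffs_in_power n A \<and> coeffs_in_power n B}"
  have "\<exists>c. c m' = 1 \<and> (\<forall>u\<in>U. (\<Sum>i\<le>m'. c i * u i) = 0)"
  proof (rule annihilating_functional)
    fix u v assume "u \<in> U" "v \<in> U"
    then obtain A1 B1 A2 B2 where *: "u = (\<lambda>i. form_pullback n A1 B1 D $ i)" "v = (\<lambda>i. form_pullback n A2 B2 D $ i)"
      "coeffs_in_power n A1" "coeffs_in_power n B1" "coeffs_in_power n A2" "coeffs_in_power n B2"
      unfolding U_def by blast
    then show "(\<lambda>i. u i + v i) \<in> U"
      unfolding U_def mem_Collect_eq
      by - (rule exI[where x = "A1 + A2"], rule exI[where x = "B1 + B2"],
          simp add: form_pullback_add coeffs_in_power_add fun_eq_iff)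
  next
    fix c u assume "u \<in> U"
    then obtain A1 B1 where *: "u = (\<lambda>i. form_pullback n A1 B1 D $ i)"
      "coeffs_in_power n A1" "coeffs_in_power n B1"
      unfolding U_def by blast
    then show "(\<lambda>i. c * u i) \<in> U"
      unfolding U_def mem_Collect_eq
      by - (rule exI[where x = "smult (fps_const c) A1"], rule exI[where x = "smult (fps_const c) B1"],
          simp add: form_pullback_smult coeffs_in_power_smult fun_eq_iff)
  next
    fix u assume "u \<in> U" "\<And>i. i < m' \<Longrightarrow> u i = 0"
    then show "u m' = 0" using no_form unfolding U_def by blast
  qed
  then obtain c where c: "c m' = 1" "\<And>u. u \<in> U \<Longrightarrow> (\<Sum>i\<le>m'. c i * u i) = 0" by blast
  define h where "h = Abs_fps (\<lambda>r. if r \<le> m' \<and> e (Suc j) dvd r then c (m' - r) else 0)"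
  define beta where "beta = fls_shift (int m') (fps_to_fls h)"
  have beta: "R.supported beta" "vanish (- int m') beta" "beta $$ (- int m') \<noteq> 0"
  proof -
    show "R.supported beta"
      unfolding R.supported_def
    proof (intro allI impI)
      fix i assume "beta $$ i \<noteq> 0"
      then have "i + int m' \<ge> 0" "e (Suc j) dvd nat (i + int m')"
        by (auto simp: beta_def h_def simp del: puiseux_e.simps split: if_splits)
      then have "int (e (Suc j)) dvd i + int m'" by (metis int_dvd_int_iff nat_0_le)
      then show "int (e (Suc j)) dvd i"
        using \<open>e (Suc j) dvd m'\<close> by (metis dvd_add_left_iff int_dvd_int_iff)
    qed
    show "vanish (- int m') beta" by (auto simp: vanish_def beta_def)
    show "beta $$ (- int m') \<noteq> 0" using c(1) by (simp add: beta_def h_def)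
  qed
  have "\<exists>A B. coeffs_in_power n A \<and> coeffs_in_power n B \<and> form_pullback n A B phi \<noteq> 0 \<and>
      int (subdegree (form_pullback n A B phi)) = int (bb (Suc (Suc j))) + - int m'"
  proof (rule R.log_form_exists[OF beta])
    fix A B assume AB: "coeffs_in_power n A" "coeffs_in_power n B"
    define f where "f = form_pullback n A B D"
    have supp: "e (Suc j) dvd i" if "f $ i \<noteq> 0" for i
    proof -
      have "fps_to_fls f $$ int i \<noteq> 0" using that by simp
      then show ?thesis using R.supported_pullback[OF AB] unfolding f_def[symmetric] R.supported_def
        by (metis int_dvd_int_iff)
    qed
    have "(beta * fps_to_fls f) $$ 0 = (h * f) $ m'"
      by (simp add: beta_def fls_shifted_times_simps flip: fls_times_fps_to_fls)
    also have "\<dots> = (\<Sum>i\<le>m'. h $ (m' - i) * f $ i)"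
      by (subst mult.commute) (simp add: fps_mult_nth atMost_atLeast0 mult.commute)
    also have "\<dots> = (\<Sum>i\<le>m'. c i * f $ i)"
    proof (rule sum.cong[OF refl])
      fix i assume i: "i \<in> {..m'}"
      have "e (Suc j) dvd m' - i" if "e (Suc j) dvd i"
        using that \<open>e (Suc j) dvd m'\<close> by (rule dvd_diff_nat[rotated])
      then show "h $ (m' - i) * f $ i = c i * f $ i"
        using i supp[of i] by (cases "f $ i = 0") (auto simp: h_def simp del: puiseux_e.simps)
    qed
    also have "\<dots> = 0" using c(2)[of "\<lambda>i. f $ i"] AB unfolding U_def f_def by blast
    finally show "(beta * fps_to_fls (form_pullback n A B D)) $$ 0 = 0" by (simp add: f_def)
  qed
  then obtain A1 B1 where "coeffs_in_power n A1" "coeffs_in_power n B1" "form_pullback n A1 B1 phi \<noteq> 0"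
     "int (subdegree (form_pullback n A1 B1 phi)) = int (bb (Suc (Suc j))) + int m - int (bb (Suc j))"
    using mm by auto
  then show ?thesis
    unfolding formal_values_def phi_def by blast
qed

lemma betabar_mono: "Suc j < g \<Longrightarrow> bb (Suc j) \<le> bb (Suc (Suc j))"
proof -
  assume j: "Suc j < g"
  have "1 \<le> e j div e (Suc j)"
    using e_dvd[of j "Suc j"] e_pos[of j] e_pos[of "Suc j"]
    by (simp add: Suc_le_eq div_greater_zero_iff dvd_imp_le del: puiseux_e.simps)
  then have "bb (Suc j) \<le> (e j div e (Suc j)) * bb (Suc j)" by simp
  moreover have "bb (Suc (Suc j)) = (e j div e (Suc j)) * bb (Suc j) + be (Suc (Suc j)) - be (Suc j)"
    by (simp del: puiseux_e.simps)
  ultimately show ?thesis using be_less[OF j] by linarith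
qed

text \<open>From m \<le> bb j the new value is at most \<open>bb k\<close>, so
  \<open>formal_step\<close> applies again. The bound bb j \<le> bb k is carried along to keep
  natural subtraction exact.\<close>

lemma formal_values_increasing:
  assumes m: "m \<in> formal_values" and j: "1 \<le> j" "j \<le> k" "k \<le> g" and le: "m \<le> bb j"
  shows "m + bb k - bb j \<in> formal_values"
proof -
  have "m + bb k - bb j \<in> formal_values \<and> bb j \<le> bb k"
    using j(2,3)
  proof (induction rule: dec_induct)
    case base
    then show ?case using m by simp
  next
    case (step k)
    obtain i where i: "k = Suc i" using step.hyps j(1) by (cases k) auto
    have 1: "m + bb k - bb j \<in> formal_values" "bb j \<le> bb k" using step by auto
    have "m + bb k - bb j \<le> bb k" using le by simp
    then obtain m' where "m' \<in> formal_values"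
      "int m' = int (bb (Suc k)) + int (m + bb k - bb j) - int (bb k)"
      using formal_step[of "m + bb k - bb j" i] 1 step.prems unfolding i by auto
    moreover have "bb k \<le> bb (Suc k)" using betabar_mono[of i] step.prems i by simp
    ultimately have "m' = m + bb (Suc k) - bb j" using 1(2) by linarith
    then show ?case
      using \<open>m' \<in> formal_values\<close> \<open>bb k \<le> bb (Suc k)\<close> 1(2) by simp
  qed
  then show ?thesis by simp
qed

end

section \<open>Germs and formal series\<close>

lemma ord0_eq_subdegree:
  assumes "h has_fps_expansion H"
  shows "has_finite_ord0 h \<longleftrightarrow> H \<noteq> 0" "H \<noteq> 0 \<Longrightarrow> ord0 h = subdegree H"
proof -
  have iff: "(deriv ^^ k) h 0 \<noteq> 0 \<longleftrightarrow> H $ k \<noteq> 0" for k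
    using fps_nth_fps_expansion[OF assms, of k] by simp
  show "has_finite_ord0 h \<longleftrightarrow> H \<noteq> 0"
    by (auto simp: has_finite_ord0_def iff fps_eq_iff)
  show "H \<noteq> 0 \<Longrightarrow> ord0 h = subdegree H"
    by (simp add: ord0_def iff subdegree_def)
qed

lemma subdegree_cong:
  assumes "F \<noteq> 0" "\<And>k. k \<le> subdegree F \<Longrightarrow> G $ k = F $ k"
  shows "G \<noteq> 0" "subdegree G = subdegree F"
proof -
  have "G $ subdegree F \<noteq> 0" using assms by simp
  then show "G \<noteq> 0" by auto
  show "subdegree G = subdegree F"
    using assms \<open>G $ subdegree F \<noteq> 0\<close>
    by (intro subdegreeI) (auto simp: nth_less_subdegree_zero)
qed

lemma fps_mult_nth_cong:
  fixes F F' G G' :: "'a::semiring_1 fps"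
  assumes "\<And>k. k \<le> M \<Longrightarrow> F $ k = F' $ k" "\<And>k. k \<le> M \<Longrightarrow> G $ k = G' $ k" "k \<le> M"
  shows "(F * G) $ k = (F' * G') $ k"
  unfolding fps_mult_nth using assms by (intro sum.cong) auto

lemma form_pullback_nth_cong:
  assumes "\<And>k. k \<le> M \<Longrightarrow> poly A y $ k = FA $ k" "\<And>k. k \<le> M \<Longrightarrow> poly B y $ k = FB $ k" "k \<le> M"
  shows "form_pullback n A B y $ k = (FA * (of_nat n * fps_X ^ n) + FB * euler y) $ k"
proof -
  have "(poly A y * w) $ k = (FA * w) $ k" "(poly B y * w) $ k = (FB * w) $ k" for w
    using fps_mult_nth_cong[OF assms(1) refl assms(3)] fps_mult_nth_cong[OF assms(2) refl assms(3)] by auto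
  then show ?thesis by (simp only: form_pullback_def fps_add_nth)
qed

lemma coeffs_in_power_mult:
  assumes "coeffs_in_power n A" "coeffs_in_power n B"
  shows "coeffs_in_power n (A * B)"
  unfolding coeffs_in_power_def
proof (intro allI impI)
  fix i m assume "coeff (A * B) i $ m \<noteq> 0"
  then have "(\<Sum>l\<le>i. \<Sum>s=0..m. coeff A l $ s * coeff B (i - l) $ (m - s)) \<noteq> 0"
    by (simp add: coeff_mult fps_sum_nth fps_mult_nth)
  then obtain l s where "s \<le> m" "coeff A l $ s * coeff B (i - l) $ (m - s) \<noteq> 0"
    by (metis (no_types, lifting) atLeastAtMost_iff sum.neutral)
  then have "n dvd s" "n dvd m - s" "s \<le> m" using assms by (auto simp: coeffs_in_power_def)
  then show "n dvd m" by (metis dvd_add le_add_diff_inverse)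
qed

lemma form_pullback_mult:
  "form_pullback n (G * A) (G * B) y = poly G y * form_pullback n A B y"
  by (simp add: form_pullback_def algebra_simps)

lemma hol_germ2_poly:
  assumes "finite X"
  shows "hol_germ2 (\<lambda>(x, y). \<Sum>(i, j)\<in>X. c i j * x ^ i * y ^ j)"
  unfolding hol_germ2_def
proof (intro exI conjI allI impI)
  define d where "d i j = (if (i, j) \<in> X then c i j else 0)" for i j
  show "(1::real) > 0" by simp
  have "(\<lambda>(i, j). norm (d i j) * 1 ^ (i + j)) summable_on X"
    using assms by (rule summable_on_finite)
  then show "(\<lambda>(i, j). norm (d i j) * 1 ^ (i + j)) summable_on UNIV"
    by (subst summable_on_cong_neutral[where T = X and g = "\<lambda>(i, j). norm (d i j) * 1 ^ (i + j)"])
      (auto simp: d_def)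
  fix x y :: complex
  have "(\<Sum>\<^sub>\<infinity>(i, j)\<in>UNIV. d i j * x ^ i * y ^ j) = (\<Sum>\<^sub>\<infinity>(i, j)\<in>X. d i j * x ^ i * y ^ j)"
    by (rule infsum_cong_neutral) (auto simp: d_def)
  also have "\<dots> = (\<Sum>(i, j)\<in>X. d i j * x ^ i * y ^ j)"
    using assms by simp
  also have "\<dots> = (\<Sum>(i, j)\<in>X. c i j * x ^ i * y ^ j)"
    by (rule sum.cong) (auto simp: d_def)
  finally show "(case (x, y) of (x, y) \<Rightarrow> \<Sum>(i, j)\<in>X. c i j * x ^ i * y ^ j)
     = (\<Sum>\<^sub>\<infinity>(i, j)\<in>UNIV. d i j * x ^ i * y ^ j)" by simp
qed

locale convergent_branch = puiseux_branch +
  assumes conv: "\<exists>r > 0. summable (\<lambda>k. norm (a k) * r ^ k)"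
    and a_0: "a 0 = 0"
begin

definition phi :: "complex fps" where "phi = Abs_fps a"

lemma phi_expansion: "puiseux_phi a has_fps_expansion phi"
proof -
  obtain r where r: "r > 0" "summable (\<lambda>k. norm (a k) * r ^ k)" using conv by blast
  have "summable (\<lambda>k. a k * of_real r ^ k)"
    by (rule summable_norm_cancel) (use r in \<open>simp add: norm_mult norm_power\<close>)
  then have "conv_radius a \<ge> norm (of_real r :: complex)" by (rule conv_radius_geI)
  then have "fps_conv_radius phi > 0"
    using r less_le_trans[of 0 "ereal r" "conv_radius a"] by (simp add: fps_conv_radius_def phi_def)
  then have "eval_fps phi has_fps_expansion phi" by (rule eval_fps_has_fps_expansion)
  moreover have "eval_fps phi = puiseux_phi a"
    by (auto simp: eval_fps_def puiseux_phi_def phi_def)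
  ultimately show ?thesis by simp
qed

text \<open>Both components of the parametrization vanish at 0, so each Taylor coefficient of a
  pullback involves finitely many monomials only.\<close>

lemma monomial_low_order:
  assumes "k < i \<or> k < j"
  shows "(fps_X ^ (n * i) * phi ^ j) $ k = 0"
proof -
  have "phi $ 0 = 0" by (simp add: phi_def a_0)
  then have "(phi ^ j) $ l = 0" if "l < j" for l
    using startsby_zero_power_prefix[of phi j] \<open>phi $ 0 = 0\<close> that by blast
  moreover have "k < n * i" if "k < i"
  proof -
    have "1 * i \<le> n * i" using sing by (intro mult_right_mono) auto
    then show ?thesis using that by linarith
  qed
  ultimately show ?thesis
    using assms by (auto simp: fps_X_power_mult_nth)
qed

section \<open>Truncated double series and their pullbacks\<close>

definition trunc_poly :: "(nat \<Rightarrow> nat \<Rightarrow> complex) \<Rightarrow> (nat \<times> nat) set \<Rightarrow> complex fps poly" where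
  "trunc_poly c X = (\<Sum>(i, j)\<in>X. monom (fps_const (c i j) * fps_X ^ (n * i)) j)"

lemma coeffs_trunc_poly: "coeffs_in_power n (trunc_poly c X)"
proof -
  have "coeffs_in_power n (monom (fps_const (c i j) * fps_X ^ (n * i)) j)" for i j
    by (auto simp: coeffs_in_power_def fps_X_power_iff split: if_splits)
  moreover have "coeffs_in_power n 0" by (simp add: coeffs_in_power_def)
  ultimately show ?thesis
    unfolding trunc_poly_def
    by (induction X rule: infinite_finite_induct) (simp_all add: coeffs_in_power_add case_prod_unfold)
qed

lemma trunc_poly_expansion:
  "(\<lambda>t. \<Sum>(i, j)\<in>X. c i j * (t ^ n) ^ i * puiseux_phi a t ^ j) has_fps_expansion poly (trunc_poly c X) phi"
proof -
  have "(\<lambda>t. \<Sum>x\<in>X. c (fst x) (snd x) * t ^ (n * fst x) * puiseux_phi a t ^ snd x) has_fps_expansion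
      (\<Sum>x\<in>X. fps_const (c (fst x) (snd x)) * fps_X ^ (n * fst x) * phi ^ snd x)"
    by (intro fps_expansion_intros phi_expansion)
  then show ?thesis
    by (simp add: trunc_poly_def poly_sum poly_monom case_prod_unfold power_mult)
qed

lemma trunc_poly_nth:
  "poly (trunc_poly c X) phi $ k = (\<Sum>(i, j)\<in>X. c i j * (fps_X ^ (n * i) * phi ^ j) $ k)"
  by (simp add: trunc_poly_def poly_sum poly_monom fps_sum_nth case_prod_unfold mult.assoc)

lemma trunc_poly_stable:
  assumes "finite X" "{..M} \<times> {..M} \<subseteq> X" "k \<le> M"
  shows "poly (trunc_poly c X) phi $ k = poly (trunc_poly c ({..M} \<times> {..M})) phi $ k"
  unfolding trunc_poly_nth
proof (rule sum.mono_neutral_right[OF assms(1,2)], intro ballI)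
  fix x assume "x \<in> X - {..M} \<times> {..M}"
  then have "k < fst x \<or> k < snd x" using assms(3) by (cases x) auto
  then show "(case x of (i, j) \<Rightarrow> c i j * (fps_X ^ (n * i) * phi ^ j) $ k) = 0"
    by (simp add: monomial_low_order case_prod_unfold)
qed

text \<open>By the M-test the composition is a uniform limit of partial sums, so its Taylor
  coefficients are limits of theirs. These are eventually constant by
  \<open>trunc_poly_stable\<close>.\<close>

lemma germ_expansion:
  assumes "hol_germ2 f"
  shows "\<exists>F. (f \<circ> puiseux_param n a) has_fps_expansion F \<and>
    (\<forall>M. \<exists>G. coeffs_in_power n G \<and> (\<forall>k\<le>M. poly G phi $ k = F $ k))"
proof -
  obtain c r where r: "r > 0" and sm: "(\<lambda>(i, j). norm (c i j) * r ^ (i + j)) summable_on (UNIV :: (nat \<times> nat) set)"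
    and f: "\<And>x y. norm x < r \<Longrightarrow> norm y < r \<Longrightarrow> f (x, y) = (\<Sum>\<^sub>\<infinity>(i, j) \<in> UNIV. c i j * x ^ i * y ^ j)"
    using assms unfolding hol_germ2_def by blast
  have "puiseux_phi a analytic_on {0}"
    using phi_expansion by (rule has_fps_expansion_imp_analytic_0)
  then obtain s where s: "s > 0" "puiseux_phi a holomorphic_on ball 0 s"
    unfolding analytic_on_def by auto
  have phi0: "puiseux_phi a 0 = 0"
    using fps_nth_fps_expansion[OF phi_expansion, of 0] by (simp add: phi_def a_0)
  have "isCont (puiseux_phi a) 0"
    using s holomorphic_on_imp_continuous_on[OF s(2)] by (auto simp: continuous_on_eq_continuous_at)
  then have "(puiseux_phi a \<longlongrightarrow> puiseux_phi a 0) (nhds 0)"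
    unfolding isCont_def tendsto_at_iff_tendsto_nhds .
  moreover have "((\<lambda>t::complex. t ^ n) \<longlongrightarrow> 0 ^ n) (nhds 0)"
    by (intro tendsto_power filterlim_ident)
  ultimately have "(puiseux_phi a \<longlongrightarrow> 0) (nhds 0)" "((\<lambda>t::complex. t ^ n) \<longlongrightarrow> 0) (nhds 0)"
    using phi0 sing by (simp_all add: zero_power)
  from this[THEN tendstoD, OF r]
  have "eventually (\<lambda>t. norm (puiseux_phi a t) < r \<and> norm (t ^ n) < r) (nhds 0)"
    by eventually_elim simp
  then obtain s' where s': "s' > 0" "\<And>t. dist t 0 < s' \<Longrightarrow> norm (puiseux_phi a t) < r \<and> norm (t ^ n) < r"
    unfolding eventually_nhds_metric by blast
  \<comment> \<open>On \<open>S\<close> the parametrization stays inside the polydisc of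
    convergence.\<close>
  define S where "S = ball (0::complex) (min s s')"
  have S: "open S" "0 \<in> S" using s s' by (auto simp: S_def)
  define T where "T x t = c (fst x) (snd x) * (t ^ n) ^ fst x * puiseux_phi a t ^ snd x" for x t
  have small: "norm (puiseux_phi a t) < r" "norm (t ^ n) < r" if "t \<in> S" for t
    using s'(2)[of t] that by (auto simp: S_def dist_commute)
  have phi_hol: "puiseux_phi a holomorphic_on S"
    using s(2) by (rule holomorphic_on_subset) (auto simp: S_def)
  have "uniform_limit S (\<lambda>X t. \<Sum>x\<in>X. T x t) (\<lambda>t. \<Sum>\<^sub>\<infinity>x\<in>UNIV. T x t) (finite_subsets_at_top UNIV)"
  proof (rule Weierstrass_m_test_general)
    fix x t assume "t \<in> S"
    have "norm (T x t) = norm (c (fst x) (snd x)) * (norm (t ^ n) ^ fst x * norm (puiseux_phi a t) ^ snd x)"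
      by (simp add: T_def norm_mult norm_power)
    also have "\<dots> \<le> norm (c (fst x) (snd x)) * (r ^ fst x * r ^ snd x)"
      using small[OF \<open>t \<in> S\<close>] r
      by (intro mult_left_mono mult_mono power_mono) auto
    finally show "norm (T x t) \<le> (case x of (i, j) \<Rightarrow> norm (c i j) * r ^ (i + j))"
      by (simp add: case_prod_unfold power_add)
  qed (rule sm)
  moreover have "(\<Sum>\<^sub>\<infinity>x\<in>UNIV. T x t) = (f \<circ> puiseux_param n a) t" if "t \<in> S" for t
    using f[OF small(2)[OF that] small(1)[OF that]] by (simp add: T_def puiseux_param_def case_prod_unfold)
  ultimately have lim: "uniform_limit S (\<lambda>X t. \<Sum>x\<in>X. T x t) (f \<circ> puiseux_param n a) (finite_subsets_at_top UNIV)"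
    using uniform_limit_cong'[of S "\<lambda>X t. \<Sum>x\<in>X. T x t" "\<lambda>X t. \<Sum>x\<in>X. T x t"
        "\<lambda>t. \<Sum>\<^sub>\<infinity>x\<in>UNIV. T x t" "f \<circ> puiseux_param n a"] by blast
  have hol: "(\<lambda>t. \<Sum>x\<in>X. T x t) holomorphic_on S" for X
    unfolding T_def by (intro holomorphic_intros phi_hol)
  obtain \<rho> where \<rho>: "\<rho> > 0" "cball 0 \<rho> \<subseteq> S"
    using S by (meson open_contains_cball)
  have hol_lim: "(f \<circ> puiseux_param n a) holomorphic_on ball 0 \<rho>"
  proof (rule holomorphic_uniform_limit)
    show "uniform_limit (cball 0 \<rho>) (\<lambda>X t. \<Sum>x\<in>X. T x t) (f \<circ> puiseux_param n a) (finite_subsets_at_top UNIV)"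
      by (rule uniform_limit_on_subset[OF lim \<rho>(2)])
    have "ball 0 \<rho> \<subseteq> S" using \<rho>(2) by (meson ball_subset_cball order_trans)
    then show "\<forall>\<^sub>F X in finite_subsets_at_top UNIV.
        continuous_on (cball 0 \<rho>) (\<lambda>t. \<Sum>x\<in>X. T x t) \<and> (\<lambda>t. \<Sum>x\<in>X. T x t) holomorphic_on ball 0 \<rho>"
      using hol \<rho>(2)
      by (intro always_eventually allI) (meson holomorphic_on_imp_continuous_on holomorphic_on_subset)
  qed auto
  define F where "F = fps_expansion (f \<circ> puiseux_param n a) 0"
  have F: "(f \<circ> puiseux_param n a) has_fps_expansion F"
    unfolding F_def using hol_lim \<rho>(1)
    by (intro analytic_at_imp_has_fps_expansion_0) (meson analytic_at centre_in_ball open_ball)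
  have Tx: "(\<lambda>t. \<Sum>x\<in>X. T x t) has_fps_expansion poly (trunc_poly c X) phi" for X
    using trunc_poly_expansion[of c X] by (simp add: T_def case_prod_unfold)
  have "poly (trunc_poly c ({..M} \<times> {..M})) phi $ k = F $ k" if "k \<le> M" for k M
  proof -
    have "((\<lambda>X. (deriv ^^ k) (\<lambda>t. \<Sum>x\<in>X. T x t) 0) \<longlongrightarrow> (deriv ^^ k) (f \<circ> puiseux_param n a) 0)
        (finite_subsets_at_top UNIV)"
      by (rule higher_deriv_complex_uniform_limit[OF lim _ _ S]) (use hol in auto)
    then have "((\<lambda>X. fact k * poly (trunc_poly c X) phi $ k) \<longlongrightarrow> fact k * F $ k) (finite_subsets_at_top UNIV)"
      using fps_nth_fps_expansion[OF Tx, where n = k] fps_nth_fps_expansion[OF F, of k] by simp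
    moreover have "\<forall>\<^sub>F X in finite_subsets_at_top UNIV. poly (trunc_poly c X) phi $ k
        = poly (trunc_poly c ({..M} \<times> {..M})) phi $ k"
      unfolding eventually_finite_subsets_at_top
      using trunc_poly_stable that by (intro exI[of _ "{..M} \<times> {..M}"]) auto
    then have "((\<lambda>X. fact k * poly (trunc_poly c X) phi $ k) \<longlongrightarrow>
        fact k * poly (trunc_poly c ({..M} \<times> {..M})) phi $ k) (finite_subsets_at_top UNIV)"
      by (intro tendsto_eventually) (auto elim: eventually_mono)
    ultimately have "fact k * poly (trunc_poly c ({..M} \<times> {..M})) phi $ k = fact k * F $ k"
      by (intro tendsto_unique[OF finite_subsets_at_top_neq_bot])
    then show ?thesis by simp
  qed
  then show ?thesis using F coeffs_trunc_poly by blast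
qed

text \<open>Cutting the coefficients of \<open>G\<close> at x-degree \<open>M\<close> leaves a
  polynomial in x and y; the omitted terms have order above \<open>M\<close> on the branch.\<close>

lemma germ_of_coeffs:
  assumes G: "coeffs_in_power n G"
  shows "\<exists>f F. hol_germ2 f \<and> (f \<circ> puiseux_param n a) has_fps_expansion F \<and> (\<forall>k\<le>M. F $ k = poly G phi $ k)"
proof -
  define X where "X = {..M} \<times> {..degree G}"
  define c where "c i j = coeff G j $ (n * i)" for i j
  define f where "f = (\<lambda>(x, y). \<Sum>(i, j)\<in>X. c i j * x ^ i * y ^ j)"
  have "hol_germ2 f" unfolding f_def by (rule hol_germ2_poly) (simp add: X_def)
  moreover have "(f \<circ> puiseux_param n a) has_fps_expansion poly (trunc_poly c X) phi"
    using trunc_poly_expansion[of c X] by (simp add: f_def o_def puiseux_param_def)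
  moreover have "poly (trunc_poly c X) phi $ k = poly G phi $ k" if "k \<le> M" for k
  proof -
    define H where "H j = (\<Sum>i\<le>M. fps_const (c i j) * fps_X ^ (n * i))" for j
    have "poly (trunc_poly c X) phi = (\<Sum>j\<le>degree G. H j * phi ^ j)"
      unfolding trunc_poly_def poly_sum X_def H_def sum_distrib_right
      by (subst sum.swap) (simp add: sum.cartesian_product case_prod_unfold poly_monom)
    moreover have "poly G phi = (\<Sum>j\<le>degree G. coeff G j * phi ^ j)"
      by (rule poly_altdef)
    moreover have "H j $ l = coeff G j $ l" if "l \<le> M" for j l
    proof (cases "n dvd l")
      case True
      then obtain q where q: "l = n * q" by auto
      have "q \<le> l" using q sing by (cases n) auto
      then have "q \<in> {..M}" using that by simp
      moreover have "(\<Sum>i\<le>M. c i j * (if l = n * i then 1 else 0)) = (\<Sum>i\<le>M. if q = i then c i j else 0)"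
        using q sing by (intro sum.cong) auto
      ultimately show ?thesis
        by (simp add: H_def fps_sum_nth fps_X_power_iff) (simp add: c_def q)
    next
      case False
      then have "H j $ l = 0" by (auto simp: H_def fps_sum_nth fps_X_power_iff intro!: sum.neutral)
      then show ?thesis using False G by (auto simp: coeffs_in_power_def)
    qed
    then have "(H j * phi ^ j) $ k = (coeff G j * phi ^ j) $ k" for j
      using fps_mult_nth_cong[of M "H j" "coeff G j" "phi ^ j" "phi ^ j" k] \<open>k \<le> M\<close> by blast
    ultimately show ?thesis by (simp add: fps_sum_nth)
  qed
  ultimately show ?thesis by blast
qed

section \<open>Convergent and formal differential values\<close>

lemma pullback_expansion:
  assumes "(A \<circ> puiseux_param n a) has_fps_expansion FA" "(B \<circ> puiseux_param n a) has_fps_expansion FB"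
  shows "\<exists>H. pullback_coeff n a A B has_fps_expansion H \<and>
    fps_X * H = FA * (of_nat n * fps_X ^ n) + FB * euler phi"
proof (intro exI conjI)
  let ?H = "FA * (fps_const (of_nat n) * fps_X ^ (n - 1)) + FB * fps_deriv phi"
  have "(\<lambda>t. (A \<circ> puiseux_param n a) t * (of_nat n * t ^ (n - 1)) + (B \<circ> puiseux_param n a) t * deriv (puiseux_phi a) t)
     has_fps_expansion ?H"
    by (intro fps_expansion_intros assms phi_expansion)
  then show "pullback_coeff n a A B has_fps_expansion ?H"
    by (simp add: pullback_coeff_def[abs_def])
  have "fps_X ^ n = fps_X * (fps_X ^ (n - 1) :: complex fps)"
    using sing by (cases n) auto
  then show "fps_X * ?H = FA * (of_nat n * fps_X ^ n) + FB * euler phi"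
    by (simp add: euler_def algebra_simps fps_of_nat)
qed

text \<open>The factor t, which passes from dt to dt/t, accounts for the \<open>+ 1\<close> in
  \<open>Lambda_Gamma\<close>.\<close>

lemma value_of_pullback:
  assumes "pullback_coeff n a A B has_fps_expansion H"
  shows "has_finite_ord0 (pullback_coeff n a A B) \<longleftrightarrow> fps_X * H \<noteq> 0"
    "fps_X * H \<noteq> 0 \<Longrightarrow> ord0 (pullback_coeff n a A B) + 1 = subdegree (fps_X * H)"
  using ord0_eq_subdegree[OF assms] by auto

lemma Lambda_eq_formal_values: "Lambda_Gamma n a = formal_values"
proof (intro set_eqI iffI)
  fix m assume "m \<in> Lambda_Gamma n a"
  then obtain A B where AB: "hol_germ2 A" "hol_germ2 B" "has_finite_ord0 (pullback_coeff n a A B)"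
    "m = ord0 (pullback_coeff n a A B) + 1" unfolding Lambda_Gamma_def by blast
  obtain FA where FA: "(A \<circ> puiseux_param n a) has_fps_expansion FA"
    "\<And>M. \<exists>G. coeffs_in_power n G \<and> (\<forall>k\<le>M. poly G phi $ k = FA $ k)" using germ_expansion[OF AB(1)] by blast
  obtain FB where FB: "(B \<circ> puiseux_param n a) has_fps_expansion FB"
    "\<And>M. \<exists>G. coeffs_in_power n G \<and> (\<forall>k\<le>M. poly G phi $ k = FB $ k)" using germ_expansion[OF AB(2)] by blast
  obtain H where H: "pullback_coeff n a A B has_fps_expansion H"
    "fps_X * H = FA * (of_nat n * fps_X ^ n) + FB * euler phi" using pullback_expansion[OF FA(1) FB(1)] by blast
  have nz: "fps_X * H \<noteq> 0" and m: "m = subdegree (fps_X * H)"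
    using value_of_pullback[OF H(1)] AB(3,4) by auto
  obtain GA where GA: "coeffs_in_power n GA" "\<And>k. k \<le> m \<Longrightarrow> poly GA phi $ k = FA $ k" using FA(2) by blast
  obtain GB where GB: "coeffs_in_power n GB" "\<And>k. k \<le> m \<Longrightarrow> poly GB phi $ k = FB $ k" using FB(2) by blast
  have "form_pullback n GA GB phi $ k = (fps_X * H) $ k" if "k \<le> m" for k
    using form_pullback_nth_cong[OF GA(2) GB(2) that] H(2) by simp
  then have "form_pullback n GA GB phi \<noteq> 0" "subdegree (form_pullback n GA GB phi) = m"
    using subdegree_cong[OF nz, of "form_pullback n GA GB phi"] m by auto
  then show "m \<in> formal_values"
    using GA(1) GB(1) unfolding formal_values_def phi_def by blast
next
  fix m assume "m \<in> formal_values"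
  then obtain GA GB where G: "coeffs_in_power n GA" "coeffs_in_power n GB"
    "form_pullback n GA GB phi \<noteq> 0" "m = subdegree (form_pullback n GA GB phi)"
    unfolding formal_values_def phi_def by blast
  obtain A FA where A: "hol_germ2 A" "(A \<circ> puiseux_param n a) has_fps_expansion FA"
    "\<And>k. k \<le> m \<Longrightarrow> FA $ k = poly GA phi $ k" using germ_of_coeffs[OF G(1)] by blast
  obtain B FB where B: "hol_germ2 B" "(B \<circ> puiseux_param n a) has_fps_expansion FB"
    "\<And>k. k \<le> m \<Longrightarrow> FB $ k = poly GB phi $ k" using germ_of_coeffs[OF G(2)] by blast
  obtain H where H: "pullback_coeff n a A B has_fps_expansion H"
    "fps_X * H = FA * (of_nat n * fps_X ^ n) + FB * euler phi" using pullback_expansion[OF A(2) B(2)] by blast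
  have "(fps_X * H) $ k = form_pullback n GA GB phi $ k" if "k \<le> m" for k
    using form_pullback_nth_cong[OF A(3)[symmetric] B(3)[symmetric] that, of n] H(2) by simp
  then have "fps_X * H \<noteq> 0" "subdegree (fps_X * H) = m"
    using subdegree_cong[OF G(3), of "fps_X * H"] G(4) by auto
  then show "m \<in> Lambda_Gamma n a"
    using value_of_pullback[OF H(1)] A(1) B(1) unfolding Lambda_Gamma_def by force
qed

text \<open>A polynomial with the same order on the branch replaces the germ; multiplying a form by
  it adds the orders.\<close>

lemma formal_values_semigroup:
  assumes m: "m \<in> formal_values" and s: "s \<in> semigroup_Gamma n a"
  shows "m + s \<in> formal_values"
proof -
  obtain f where f: "hol_germ2 f" "has_finite_ord0 (f \<circ> puiseux_param n a)" "s = ord0 (f \<circ> puiseux_param n a)"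
    using s unfolding semigroup_Gamma_def by blast
  obtain F where F: "(f \<circ> puiseux_param n a) has_fps_expansion F"
    "\<And>M. \<exists>G. coeffs_in_power n G \<and> (\<forall>k\<le>M. poly G phi $ k = F $ k)" using germ_expansion[OF f(1)] by blast
  have nz: "F \<noteq> 0" and sF: "s = subdegree F" using ord0_eq_subdegree[OF F(1)] f by auto
  obtain G where G: "coeffs_in_power n G" "\<And>k. k \<le> s \<Longrightarrow> poly G phi $ k = F $ k" using F(2) by blast
  have G': "poly G phi \<noteq> 0" "subdegree (poly G phi) = s"
    using subdegree_cong[OF nz, of "poly G phi"] G(2) sF by auto
  obtain A B where AB: "coeffs_in_power n A" "coeffs_in_power n B"
    "form_pullback n A B phi \<noteq> 0" "m = subdegree (form_pullback n A B phi)"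
    using m unfolding formal_values_def phi_def by blast
  have "form_pullback n (G * A) (G * B) phi \<noteq> 0" "m + s = subdegree (form_pullback n (G * A) (G * B) phi)"
    using G' AB(3,4) by (simp_all add: form_pullback_mult)
  then show ?thesis
    using coeffs_in_power_mult[OF G(1) AB(1)] coeffs_in_power_mult[OF G(1) AB(2)]
    unfolding formal_values_def phi_def by blast
qed

end

theorem theorem1p1:
  fixes n :: nat and a :: "nat \<Rightarrow> complex"
  assumes sing: "n \<ge> 2"
    and conv: "\<exists>r > 0. summable (\<lambda>k. norm (a k) * r ^ k)"
    and prim: "\<forall>d::nat. d dvd n \<and> (\<forall>k. a k \<noteq> 0 \<longrightarrow> d dvd k) \<longrightarrow> d = 1"
    and mult: "n < puiseux_beta n a 1"
    and supp: "\<forall>k. a k \<noteq> 0 \<longrightarrow> puiseux_beta n a 1 \<le> k"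
  shows "(\<forall>m \<in> Lambda_Gamma n a. \<forall>s \<in> semigroup_Gamma n a. m + s \<in> Lambda_Gamma n a)
       \<and> (\<forall>m \<in> Lambda_Gamma n a. \<forall>j k. 1 \<le> j \<and> j \<le> k \<and> k \<le> puiseux_g n a
             \<and> m \<le> puiseux_betabar n a j
             \<longrightarrow> m + puiseux_betabar n a k - puiseux_betabar n a j \<in> Lambda_Gamma n a)"
proof -
  \<comment> \<open>Here \<open>a 0 = 0\<close> holds because \<open>supp\<close> and
    \<open>mult\<close> place all exponents above n.\<close>
  interpret convergent_branch n a
    using sing conv prim mult supp by unfold_locales auto
  show ?thesis
    unfolding Lambda_eq_formal_values
    using formal_values_semigroup formal_values_increasing by blast
qed

end
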